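(* Let $\mathbf{k}$ be an algebraically closed field of characteristic $p>0$. Let $a,b,j$ be non-negative integers and $r$ a positive integer, and set $d=a+b-1-j$, $e=j-1$. Then the following are equivalent: \begin{enumerate} \item $\delta_r(-j)$ appears as a summand in $\delta_a\delta_b$; \item $\displaystyle\left(\frac{J(d-1,r-1)}{J(d,r)}\right)_{a-1+r-d,\ b-1+r-d}\neq0$; \item the map $H^0(\mathbf{P}^1,\beta)$ fails to be surjective in bi-degree $(a-1,b-1)$, where $\beta$ is the surjection in the exact sequence \[0\to\mathcal{F}^d_r(e)\xrightarrow{\alpha}\mathcal{F}^d_{r+1}(e)\oplus\mathcal{F}^{d-1}_{r-1}(e+1)\xrightarrow{\beta}\mathcal{F}^{d-1}_r(e+1)\to0.\] \end{enumerate}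
   Context: **Han--Monsky ring.** In the category of finite length graded $\mathbf{k}[T]$-modules, $M\otimes_{\mathbf{k}}N$ carries the action $T(m\otimes n)=Tm\otimes n+m\otimes Tn$; products are taken in the split Grothendieck ring. $\delta_c$ is the class of $\mathbf{k}[T]/(T^c)$ ($\delta_0=0$) and $\delta_c(-j)$ is the same module with generator in degree $j$. Summands refer to the Krull--Schmidt decomposition into modules $\delta_c(-j)$. **Sheaves on $\mathbf{P}^1$.** Let $U=\mathbf{k}^2$ with basis $x_1,x_2$, $S=\operatorname{Sym}U=\mathbf{k}[x_1,x_2]$, $\mathbf{P}^1=\operatorname{Proj}S$, and let the torus $T=\mathbb{G}_m^2$ of diagonal matrices act, giving $\mathbb{Z}^2$-gradings ($\deg x_1=(1,0)$, $\deg x_2=(0,1)$). $D^mU$ is the $m$-th divided power ($0$ if $m<0$). Let $\omega:D^mU\otimes S\to D^{m-1}U\otimes S$ be the $S$-linear, bidegree-preserving map given by comultiplication $D^mU\to D^{m-1}U\otimes U$ followed by multiplication $U\otimes S\to S$. Put $F^d_r=\ker(\omega^r:D^dU\otimes S\to D^{d-r}U\otimes S)$, and let $\mathcal{F}^d_r$ be the associated sheaf, i.e. the kernel of the induced map $D^dU\otimes\mathcal{O}_{\mathbf{P}^1}\to D^{d-r}U\otimes\mathcal{O}_{\mathbf{P}^1}(r)$ (so $\mathcal{F}^d_0=0$, and $\mathcal{F}^d_r=D^dU\otimes\mathcal{O}$ for $d<r$). The maps are $\alpha(f)=(f,\omega f)$ and $\beta(f,g)=\omega f-g$, using the inclusions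 $\mathcal{F}^d_r\subseteq\mathcal{F}^d_{r+1}$, $\mathcal{F}^{d-1}_{r-1}\subseteq\mathcal{F}^{d-1}_r$. **Ideals $J(d,r)$.** For $m\ge0$, $F^m_1$ is a free $S$-module of rank one generated in bidegree $(m,m)$, $F^m_1\cong L_{m,m}\otimes S$, where $L_{m,m}$ is the one-dimensional $T$-representation of weight $(m,m)$. For $d\ge r\ge0$, $\omega^r$ maps $F^d_{r+1}$ to $F^{d-r}_1\cong L_{d-r,d-r}\otimes S$, and $J(d,r)\subseteq S$ is the $\mathfrak{m}$-primary monomial ideal ($\mathfrak{m}=\langle x_1,x_2\rangle$; possibly $J(d,r)=S$) such that the image is $L_{d-r,d-r}\otimes J(d,r)$. If $q$ is a power of $p$ with $r<q$, then for $d\ge r$ the ideal $J(d,r)$ depends only on $d$ modulo $q$; for $d<r$ one defines $J(d,r)=J(\tilde d,r)$ for any $\tilde d\ge r$ with $q\mid\tilde d-d$. One has $J(d,r)\subseteq J(d-1,r-1)$; subscripts denote components of the $\mathbb{Z}^2$-grading. *)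

theory Defs
  imports
    "HOL-Computational_Algebra.Computational_Algebra"
    "HOL-Algebra.Algebraic_Closure_Type"
begin

section \<open>Graded modules over \<open>k[T]\<close>\<close>

text \<open>
  A graded \<open>k[T]\<close>-module of finite length is a finite-dimensional graded vector space with an
  operator \<open>T\<close> of degree 1.  It is given here by a finite homogeneous basis, the degrees of the
  basis elements, and the matrix of \<open>T\<close>: \<open>Act M b b'\<close> is the coefficient of \<open>b'\<close> in \<open>T b\<close>.
\<close>

record ('k, 'b) gmod =
  Basis :: "'b set"
  Deg :: "'b \<Rightarrow> int"
  Act :: "'b \<Rightarrow> 'b \<Rightarrow> 'k"

definition gvectors :: "('k::field, 'b) gmod \<Rightarrow> ('b \<Rightarrow> 'k) set" where
  "gvectors M = {v. \<forall>b. v b \<noteq> 0 \<longrightarrow> b \<in> Basis M}"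

definition gcomponent :: "('k::field, 'b) gmod \<Rightarrow> int \<Rightarrow> ('b \<Rightarrow> 'k) set" where
  "gcomponent M n = {v \<in> gvectors M. \<forall>b. v b \<noteq> 0 \<longrightarrow> Deg M b = n}"

definition Top :: "('k::field, 'b) gmod \<Rightarrow> ('b \<Rightarrow> 'k) \<Rightarrow> 'b \<Rightarrow> 'k" where
  "Top M v = (\<lambda>b'. \<Sum>b\<in>Basis M. v b * Act M b b')"

definition giso :: "('k::field, 'b) gmod \<Rightarrow> ('k, 'c) gmod \<Rightarrow> bool" where
  "giso M N \<longleftrightarrow>
     (\<exists>\<phi>. bij_betw \<phi> (gvectors M) (gvectors N) \<and>
          (\<forall>v\<in>gvectors M. \<forall>w\<in>gvectors M. \<phi> (\<lambda>b. v b + w b) = (\<lambda>b. \<phi> v b + \<phi> w b)) \<and>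
          (\<forall>c. \<forall>v\<in>gvectors M. \<phi> (\<lambda>b. c * v b) = (\<lambda>b. c * \<phi> v b)) \<and>
          (\<forall>v\<in>gvectors M. \<phi> (Top M v) = Top N (\<phi> v)) \<and>
          (\<forall>n. \<phi> ` gcomponent M n \<subseteq> gcomponent N n))"

text \<open>\<open>delta c j\<close> is \<open>k[T]/(T\<^sup>c)\<close> with generator in degree \<open>j\<close>, i.e. \<open>\<delta>\<^sub>c(-j)\<close>; the basis element
  \<open>i\<close> stands for \<open>T\<^sup>i\<close>.\<close>

definition delta :: "nat \<Rightarrow> int \<Rightarrow> ('k::field, nat) gmod" where
  "delta c j =
     \<lparr>Basis = {..<c}, Deg = (\<lambda>i. j + int i),
      Act = (\<lambda>i i'. if i' = Suc i \<and> i' < c then 1 else 0)\<rparr>"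

definition gtensor :: "('k::field, 'b) gmod \<Rightarrow> ('k, 'c) gmod \<Rightarrow> ('k, 'b \<times> 'c) gmod" where
  "gtensor M N =
     \<lparr>Basis = Basis M \<times> Basis N, Deg = (\<lambda>(b, c). Deg M b + Deg N c),
      Act = (\<lambda>(b, c) (b', c'). (if c = c' then Act M b b' else 0) +
                               (if b = b' then Act N c c' else 0))\<rparr>"

definition gdirect_sum :: "('k::field, 'b) gmod list \<Rightarrow> ('k, nat \<times> 'b) gmod" where
  "gdirect_sum Ms =
     \<lparr>Basis = (SIGMA l:{..<length Ms}. Basis (Ms ! l)), Deg = (\<lambda>(l, b). Deg (Ms ! l) b),
      Act = (\<lambda>(l, b) (l', b'). if l = l' then Act (Ms ! l) b b' else 0)\<rparr>"

definition KS_decomposition :: "('k::field, 'b) gmod \<Rightarrow> (nat \<times> int) list \<Rightarrow> bool" where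
  "KS_decomposition M cs \<longleftrightarrow>
     (\<forall>(c, j) \<in> set cs. 0 < c) \<and> giso M (gdirect_sum (map (\<lambda>(c, j). delta c j) cs))"

definition delta_summand :: "nat \<Rightarrow> int \<Rightarrow> ('k::field, 'b) gmod \<Rightarrow> bool" where
  "delta_summand r j M \<longleftrightarrow> (\<exists>cs. KS_decomposition M cs \<and> (r, j) \<in> set cs)"


section \<open>The bigraded ring \<open>S = k[x\<^sub>1,x\<^sub>2]\<close> and the modules \<open>F\<^sup>d\<^sub>r\<close>\<close>

text \<open>\<open>S\<close> is the type \<open>'k poly poly\<close>, with \<open>x\<^sub>1\<close> the inner and \<open>x\<^sub>2\<close> the outer variable: the
  coefficient of \<open>x\<^sub>1\<^sup>s x\<^sub>2\<^sup>t\<close> in \<open>f\<close> is \<open>coeff (coeff f t) s\<close>.\<close>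

definition x1 :: "'k::field poly poly" where "x1 = [:[:0, 1:]:]"
definition x2 :: "'k::field poly poly" where "x2 = [:0, 1:]"

definition bihomogeneous :: "int \<Rightarrow> int \<Rightarrow> 'k::field poly poly \<Rightarrow> bool" where
  "bihomogeneous u v f \<longleftrightarrow>
     (\<forall>s t. Polynomial.coeff (Polynomial.coeff f t) s \<noteq> 0 \<longrightarrow> int s = u \<and> int t = v)"

text \<open>
  For a commutative ring \<open>R\<close>, an element of \<open>D\<^sup>mU \<otimes> R\<close> is the function \<open>f\<close> taking \<open>(i,j)\<close> to its
  coefficient at the basis element \<open>x\<^sub>1\<^sup>(\<^sup>i\<^sup>)x\<^sub>2\<^sup>(\<^sup>j\<^sup>)\<close>, which has weight \<open>(i,j)\<close>; thus \<open>D\<^sup>mU = 0\<close> for \<open>m < 0\<close>.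
  Since comultiplication takes \<open>x\<^sub>1\<^sup>(\<^sup>i\<^sup>)x\<^sub>2\<^sup>(\<^sup>j\<^sup>)\<close> to
  \<open>x\<^sub>1\<^sup>(\<^sup>i\<^sup>-\<^sup>1\<^sup>)x\<^sub>2\<^sup>(\<^sup>j\<^sup>) \<otimes> x\<^sub>1 + x\<^sub>1\<^sup>(\<^sup>i\<^sup>)x\<^sub>2\<^sup>(\<^sup>j\<^sup>-\<^sup>1\<^sup>) \<otimes> x\<^sub>2\<close>, the map \<open>\<omega>\<close> is \<open>omega X1 X2\<close> below, where \<open>X1\<close>, \<open>X2\<close>
  are the images of \<open>x\<^sub>1\<close>, \<open>x\<^sub>2\<close> in \<open>R\<close>.
\<close>

definition DU :: "int \<Rightarrow> (nat \<Rightarrow> nat \<Rightarrow> 'a::zero) set" where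
  "DU m = {f. \<forall>i j. f i j \<noteq> 0 \<longrightarrow> int (i + j) = m}"

definition omega :: "'a::comm_ring_1 \<Rightarrow> 'a \<Rightarrow> (nat \<Rightarrow> nat \<Rightarrow> 'a) \<Rightarrow> nat \<Rightarrow> nat \<Rightarrow> 'a" where
  "omega X1 X2 f = (\<lambda>i j. X1 * f (Suc i) j + X2 * f i (Suc j))"

definition F_module :: "int \<Rightarrow> nat \<Rightarrow> (nat \<Rightarrow> nat \<Rightarrow> 'k::field poly poly) set" where
  "F_module d r = {f \<in> DU d. (omega x1 x2 ^^ r) f = (\<lambda>i j. 0)}"


section \<open>The ideals \<open>J(d,r)\<close>\<close>

definition F1_generator :: "int \<Rightarrow> (nat \<Rightarrow> nat \<Rightarrow> 'k::field poly poly) \<Rightarrow> bool" where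
  "F1_generator m g \<longleftrightarrow>
     (\<forall>i j. bihomogeneous (m - int i) (m - int j) (g i j)) \<and>
     F_module m 1 = range (\<lambda>s i j. s * g i j)"

text \<open>The generator is unique up to a unit of \<open>k\<close>, so its choice does not matter.\<close>

definition J_base :: "int \<Rightarrow> nat \<Rightarrow> 'k::field poly poly set" where
  "J_base d r =
     {s. \<exists>g. F1_generator (d - int r) g \<and>
             (\<lambda>i j. s * g i j) \<in> (omega x1 x2 ^^ r) ` F_module d (r + 1)}"

text \<open>For \<open>d < r\<close> the ideal is the common value of \<open>J(d',r)\<close> over all admissible \<open>q\<close> and \<open>d'\<close>.\<close>

definition J_ideal :: "int \<Rightarrow> nat \<Rightarrow> 'k::field poly poly set" where
  "J_ideal d r =
     (if int r \<le> d then J_base d r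
      else (THE I. \<exists>n d'. r < CHAR('k) ^ n \<and> int r \<le> d' \<and> int (CHAR('k) ^ n) dvd d' - d \<and>
                          I = J_base d' r))"

text \<open>The component of bidegree \<open>(u,v)\<close> of \<open>I/J\<close> as a set of cosets; its zero element is \<open>J\<close>.\<close>

definition quotient_component ::
  "'k::field poly poly set \<Rightarrow> 'k poly poly set \<Rightarrow> int \<Rightarrow> int \<Rightarrow> 'k poly poly set set" where
  "quotient_component I J u v = {(\<lambda>s. f + s) ` J |f. f \<in> I \<and> bihomogeneous u v f}"


section \<open>Sheaves on \<open>P\<^sup>1 = Proj S\<close>\<close>

definition homogeneous :: "int \<Rightarrow> 'k::field poly poly \<Rightarrow> bool" where
  "homogeneous n f \<longleftrightarrow>
     (\<forall>s t. Polynomial.coeff (Polynomial.coeff f t) s \<noteq> 0 \<longrightarrow> int (s + t) = n)"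

definition homogeneous_part :: "nat \<Rightarrow> 'k::field poly poly \<Rightarrow> 'k poly poly" where
  "homogeneous_part n f =
     (\<Sum>t\<le>n. Polynomial.monom (Polynomial.monom (Polynomial.coeff (Polynomial.coeff f t) (n - t)) (n - t)) t)"

definition Proj :: "'k::field poly poly set set" where
  "Proj = {P. primeideal P ring_of_type_algebra \<and> (\<forall>f\<in>P. \<forall>n. homogeneous_part n f \<in> P) \<and>
              \<not> {x1, x2} \<subseteq> P}"

definition Proj_open :: "'k::field poly poly set set \<Rightarrow> bool" where
  "Proj_open V \<longleftrightarrow> (\<exists>A. A \<subseteq> {f. \<exists>n. homogeneous n f} \<and> V = {P \<in> Proj. \<not> A \<subseteq> P})"

text \<open>
  Sections of \<open>\<O>(n)\<close> over an open set \<open>U\<close>: functions on \<open>U\<close> that are locally of the form \<open>f/g\<close>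
  with \<open>f\<close>, \<open>g\<close> homogeneous, \<open>deg f - deg g = n\<close>, and \<open>g\<close> in none of the primes concerned.  As \<open>S\<close> is
  a domain, the localizations at the points are taken inside its field of fractions.  Sections
  are extended by \<open>0\<close> outside \<open>U\<close>.
\<close>

definition O_sections ::
  "int \<Rightarrow> 'k::field poly poly set set \<Rightarrow> ('k poly poly set \<Rightarrow> 'k poly poly fract) set" where
  "O_sections n U =
     {s. (\<forall>P\<in>U. \<exists>V f g m. Proj_open V \<and> P \<in> V \<and> V \<subseteq> U \<and>
            homogeneous (m + n) f \<and> homogeneous m g \<and>
            (\<forall>Q\<in>V. g \<notin> Q \<and> s Q = Fract f g)) \<and>
         (\<forall>P. P \<notin> U \<longrightarrow> s P = 0)}"

definition DO_sections ::
  "int \<Rightarrow> int \<Rightarrow> 'k::field poly poly set set \<Rightarrow>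
     ('k poly poly set \<Rightarrow> nat \<Rightarrow> nat \<Rightarrow> 'k poly poly fract) set" where
  "DO_sections d n U =
     {\<sigma>. (\<forall>P. \<sigma> P \<in> DU d) \<and> (\<forall>i j. (\<lambda>P. \<sigma> P i j) \<in> O_sections n U)}"

abbreviation omega_fract ::
  "(nat \<Rightarrow> nat \<Rightarrow> 'k::field poly poly fract) \<Rightarrow> nat \<Rightarrow> nat \<Rightarrow> 'k poly poly fract" where
  "omega_fract \<equiv> omega (Fract x1 1) (Fract x2 1)"

text \<open>Twisting by \<open>\<O>(n)\<close> is exact, so \<open>\<F>\<^sup>d\<^sub>r(n)\<close> is the kernel of
  \<open>\<omega>\<^sup>r : D\<^sup>dU \<otimes> \<O>(n) \<rightarrow> D\<^sup>d\<^sup>-\<^sup>rU \<otimes> \<O>(n+r)\<close>.\<close>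

definition F_sections ::
  "int \<Rightarrow> nat \<Rightarrow> int \<Rightarrow> 'k::field poly poly set set \<Rightarrow>
     ('k poly poly set \<Rightarrow> nat \<Rightarrow> nat \<Rightarrow> 'k poly poly fract) set" where
  "F_sections d r n U =
     {\<sigma> \<in> DO_sections d n U. \<forall>P. (omega_fract ^^ r) (\<sigma> P) = (\<lambda>i j. 0)}"

definition beta ::
  "('k::field poly poly set \<Rightarrow> nat \<Rightarrow> nat \<Rightarrow> 'k poly poly fract) \<times>
   ('k poly poly set \<Rightarrow> nat \<Rightarrow> nat \<Rightarrow> 'k poly poly fract) \<Rightarrow>
   'k poly poly set \<Rightarrow> nat \<Rightarrow> nat \<Rightarrow> 'k poly poly fract" where
  "beta = (\<lambda>(\<sigma>, \<tau>). \<lambda>P i j. omega_fract (\<sigma> P) i j - \<tau> P i j)"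

text \<open>The weight spaces of the torus in the field of fractions of \<open>S\<close>.\<close>

definition bihomogeneous_fract :: "int \<Rightarrow> int \<Rightarrow> 'k::field poly poly fract \<Rightarrow> bool" where
  "bihomogeneous_fract u v z \<longleftrightarrow>
     (\<exists>c. z = Fract [:[:c:]:] 1 * Fract x1 1 powi u * Fract x2 1 powi v)"

text \<open>\<open>H\<^sup>0(P\<^sup>1, \<F>\<^sup>d\<^sub>r(n))\<close> in bidegree \<open>(u,v)\<close>.  A global section has the same value in the field of
  fractions at all points, so its weight is read off from its values.\<close>

definition H0_F ::
  "int \<Rightarrow> nat \<Rightarrow> int \<Rightarrow> int \<Rightarrow> int \<Rightarrow>
     ('k::field poly poly set \<Rightarrow> nat \<Rightarrow> nat \<Rightarrow> 'k poly poly fract) set" where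
  "H0_F d r n u v =
     {\<sigma> \<in> F_sections d r n Proj.
        \<forall>P i j. bihomogeneous_fract (u - int i) (v - int j) (\<sigma> P i j)}"

end

theory Submission
  imports Defs "HOL-Library.Function_Algebras"
begin

text \<open>
  In bidegree \<open>(a-1,b-1)\<close> the operator \<open>\<omega>\<close> on \<open>D\<^sup>dU \<otimes> S\<close> is, up to duality, multiplication by \<open>T = x + y\<close>
  on \<open>\<delta>\<^sub>a\<delta>\<^sub>b = k[x,y]/(x\<^sup>a,y\<^sup>b)\<close>, from degree \<open>j-1\<close> to degree \<open>j\<close>.  The multiplicity of \<open>\<delta>\<^sub>r(-j)\<close> is the
  dimension of \<open>ker T\<^sup>r / (ker T\<^sup>r\<^sup>-\<^sup>1 + T ker T\<^sup>r\<^sup>+\<^sup>1)\<close> in degree \<open>j\<close>, which is the cokernel of \<open>\<beta>\<close> on global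
  sections.  Applying \<open>T\<^sup>r\<^sup>-\<^sup>1\<close> identifies this quotient with \<open>T\<^sup>r\<^sup>-\<^sup>1 ker T\<^sup>r / T\<^sup>r ker T\<^sup>r\<^sup>+\<^sup>1\<close>; both terms lie in
  the kernel of \<open>T\<close>, of dimension at most one in each degree, and this is the component of
  \<open>J(d-1,r-1)/J(d,r)\<close>.  If \<open>d < r\<close>, all three conditions fail.  For the second this follows from a
  description of the monomials in \<open>J(d,r)\<close> by zeros of combinations of binomial coefficients
  \<open>binom(i,k)\<close> with \<open>k \<le> r\<close>, which also gives the periodicity in \<open>d\<close>.
\<close>

section \<open>Strings in graded modules\<close>

text \<open>The three conditions are never compared directly: each is translated into
  \<open>string_class\<close>, a statement about scalar arrays in an \<open>a\<close> by
  \<open>b\<close> box from which \<open>x1\<close> and \<open>x2\<close> have disappeared. On the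
  module side, \<open>has_string\<close> is an isomorphism invariant that reads off from a sum of
  cyclic modules whether \<open>(r, j)\<close> occurs, so the work left is the existence of a
  decomposition. On the ideal side, a preimage of the kernel generator under the r-th power of
  \<open>omega1\<close> is, along an antidiagonal and up to signs, a sequence with constant r-th
  difference, that is, a polynomial of degree \<open>r\<close> with fixed leading coefficient in the
  basis \<open>binom(i,k)\<close>. Lying in the box means vanishing at both ends of the interval
  \<open>0..m+r\<close>. In characteristic p, \<open>binom(i,k)\<close> has period q in i as soon as
  \<open>k < q\<close>; as k is at most r, this is where the condition \<open>r < q\<close> comes
  from. The obstacle is \<open>d < r\<close>, where \<open>J(d,r)\<close> is a definite description:
  periodicity is what evaluates it, and the polynomial \<open>binom(i,r)\<close> then shows that
  \<open>J(d,r)\<close> fills the bidegree in question.\<close>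

definition scl :: "'k::field \<Rightarrow> ('b \<Rightarrow> 'k) \<Rightarrow> 'b \<Rightarrow> 'k" where
  "scl c f = (\<lambda>b. c * f b)"

declare plus_fun_apply [simp del] zero_fun_apply [simp del] minus_apply [simp del]

lemma scl_apply: "scl c f b = c * f b"
  by (simp add: scl_def)

lemma minus_fun_apply: "(f - g) b = f b - (g b :: 'k::group_add)"
  by (simp add: fun_diff_def)

lemmas fun_apply_simps = plus_fun_apply zero_fun_apply minus_fun_apply scl_apply

interpretation fs: vector_space scl
  by standard (auto simp: fun_eq_iff fun_apply_simps algebra_simps)

abbreviation flinear :: "(('b \<Rightarrow> 'k::field) \<Rightarrow> ('c \<Rightarrow> 'k)) \<Rightarrow> bool" where
  "flinear \<equiv> module_hom scl scl"

lemma flinearI: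
  assumes "\<And>v w. f (v + w) = f v + f w" "\<And>c v. f (scl c v) = scl c (f v)"
  shows "flinear f"
  using assms by unfold_locales (auto simp: fun_eq_iff fun_apply_simps algebra_simps)

lemma flinear_pow:
  fixes f :: "('b \<Rightarrow> 'k::field) \<Rightarrow> 'b \<Rightarrow> 'k"
  shows "flinear f \<Longrightarrow> flinear (f ^^ n)"
proof (induction n)
  case 0
  show ?case by (rule flinearI) simp_all
next
  case (Suc n)
  then show ?case
    by (intro flinearI) (simp_all add: module_hom.add module_hom.scale)
qed

lemma sum_fun_apply: "(\<Sum>x\<in>A. f x) b = (\<Sum>x\<in>A. f x b)"
  by (induction A rule: infinite_finite_induct) (auto simp: fun_apply_simps)

lemma Top_linear: "flinear (Top M)"
  by (intro flinearI) (auto simp: Top_def fun_eq_iff fun_apply_simps algebra_simps sum.distrib sum_distrib_left)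

text \<open>The record \<open>gmod\<close> admits arbitrary matrices; this predicate singles out
  those that are graded modules of finite length, with \<open>T\<close> of degree 1.\<close>

definition graded :: "('k::field, 'b) gmod \<Rightarrow> bool" where
  "graded M \<longleftrightarrow> finite (Basis M) \<and>
     (\<forall>b\<in>Basis M. \<forall>b'. Act M b b' \<noteq> 0 \<longrightarrow> b' \<in> Basis M \<and> Deg M b' = Deg M b + 1)"

lemma gvectors_subspace: "fs.subspace (gvectors M)"
  by (rule fs.subspaceI) (auto simp: gvectors_def fun_apply_simps, metis add.right_neutral)

lemma gcomponent_subspace: "fs.subspace (gcomponent M n)"
  by (rule fs.subspaceI) (auto simp: gcomponent_def gvectors_def fun_apply_simps, (metis add.right_neutral)+)

lemma gcomponent_subset: "gcomponent M n \<subseteq> gvectors M"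
  by (auto simp: gcomponent_def)

lemma Top_gcomponent:
  assumes "graded M" "v \<in> gcomponent M n"
  shows "Top M v \<in> gcomponent M (n + 1)"
proof -
  have "b' \<in> Basis M \<and> Deg M b' = n + 1" if nz: "Top M v b' \<noteq> 0" for b'
  proof -
    obtain b where "b \<in> Basis M" "v b * Act M b b' \<noteq> 0"
      using nz unfolding Top_def by (meson sum.not_neutral_contains_not_neutral)
    then show ?thesis using assms by (auto simp: graded_def gcomponent_def)
  qed
  then show ?thesis by (auto simp: gcomponent_def gvectors_def)
qed

lemma Top_pow_gcomponent:
  assumes "graded M" "v \<in> gcomponent M n"
  shows "(Top M ^^ k) v \<in> gcomponent M (n + int k)"
proof (induction k)
  case (Suc k)
  then show ?case using Top_gcomponent[OF assms(1) Suc] by (simp add: algebra_simps)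
qed (use assms in auto)

definition gpart :: "('k::field, 'b) gmod \<Rightarrow> int \<Rightarrow> ('b \<Rightarrow> 'k) \<Rightarrow> 'b \<Rightarrow> 'k" where
  "gpart M n v = (\<lambda>b. if Deg M b = n then v b else 0)"

lemma gpart_linear: "flinear (gpart M n)"
  by (intro flinearI) (auto simp: gpart_def fun_eq_iff fun_apply_simps)

lemma gpart_gcomponent: "v \<in> gvectors M \<Longrightarrow> gpart M n v \<in> gcomponent M n"
  by (auto simp: gpart_def gcomponent_def gvectors_def)

lemma gpart_eq: "v \<in> gcomponent M m \<Longrightarrow> gpart M n v = (if m = n then v else 0)"
  by (auto simp: gpart_def gcomponent_def fun_eq_iff fun_apply_simps)

lemma gparts_sum:
  assumes "finite (Basis M)" "v \<in> gvectors M"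
  shows "v = (\<Sum>n\<in>Deg M ` Basis M. gpart M n v)"
proof
  fix b
  have "(\<Sum>n\<in>Deg M ` Basis M. if Deg M b = n then v b else 0) = v b"
    using assms by (auto simp: gvectors_def)
  then show "v b = (\<Sum>n\<in>Deg M ` Basis M. gpart M n v) b"
    by (simp add: gpart_def sum_fun_apply)
qed

section \<open>Graded isomorphisms and the invariance of strings\<close>

definition giso_map :: "(('b \<Rightarrow> 'k) \<Rightarrow> ('c \<Rightarrow> 'k)) \<Rightarrow> ('k::field, 'b) gmod \<Rightarrow> ('k, 'c) gmod \<Rightarrow> bool" where
  "giso_map \<phi> M N \<longleftrightarrow> bij_betw \<phi> (gvectors M) (gvectors N) \<and>
          (\<forall>v\<in>gvectors M. \<forall>w\<in>gvectors M. \<phi> (v + w) = \<phi> v + \<phi> w) \<and>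
          (\<forall>c. \<forall>v\<in>gvectors M. \<phi> (scl c v) = scl c (\<phi> v)) \<and>
          (\<forall>v\<in>gvectors M. \<phi> (Top M v) = Top N (\<phi> v)) \<and>
          (\<forall>n. \<phi> ` gcomponent M n \<subseteq> gcomponent N n)"

lemma giso_iff: "giso M N \<longleftrightarrow> (\<exists>\<phi>. giso_map \<phi> M N)"
  by (simp add: giso_def giso_map_def plus_fun_def scl_def)

lemma giso_map_zero:
  assumes "giso_map \<phi> M N" shows "\<phi> 0 = 0"
proof -
  have "0 \<in> gvectors M" by (simp add: gvectors_def zero_fun_apply)
  then have "\<phi> (scl 0 0) = scl 0 (\<phi> 0)" using assms unfolding giso_map_def by blast
  then show ?thesis by simp
qed

lemma giso_map_sum:
  assumes \<phi>: "giso_map \<phi> M N" and "\<And>x. x \<in> A \<Longrightarrow> f x \<in> gvectors M"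
  shows "\<phi> (\<Sum>x\<in>A. f x) = (\<Sum>x\<in>A. \<phi> (f x))"
  using assms(2)
proof (induction A rule: infinite_finite_induct)
  case (insert x F)
  have "sum f F \<in> gvectors M"
    using insert by (intro fs.subspace_sum[OF gvectors_subspace]) auto
  moreover have "f x \<in> gvectors M" using insert by simp
  ultimately have "\<phi> (f x + sum f F) = \<phi> (f x) + \<phi> (sum f F)"
    using \<phi> unfolding giso_map_def by blast
  then show ?case using insert by simp
qed (use giso_map_zero[OF \<phi>] in auto)

lemma giso_map_gpart:
  assumes \<phi>: "giso_map \<phi> M N" and "finite (Basis M)" and v: "v \<in> gvectors M"
  shows "gpart N n (\<phi> v) = \<phi> (gpart M n v)"
proof -
  have comp: "gpart M m v \<in> gvectors M" "\<phi> (gpart M m v) \<in> gcomponent N m" for m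
    using gpart_gcomponent[OF v, of m] \<phi> gcomponent_subset unfolding giso_map_def by blast+
  have "gpart N n (\<phi> v) = gpart N n (\<phi> (\<Sum>m\<in>Deg M ` Basis M. gpart M m v))"
    using gparts_sum assms by metis
  also have "\<dots> = (\<Sum>m\<in>Deg M ` Basis M. gpart N n (\<phi> (gpart M m v)))"
    by (simp add: giso_map_sum[OF \<phi>] comp module_hom.sum[OF gpart_linear])
  also have "\<dots> = (\<Sum>m\<in>Deg M ` Basis M. if m = n then \<phi> (gpart M n v) else 0)"
    using gpart_eq[OF comp(2)] by (intro sum.cong) auto
  also have "\<dots> = \<phi> (gpart M n v)"
  proof (cases "n \<in> Deg M ` Basis M")
    case False
    then have "gpart M n v = 0"
      using v by (auto simp: gpart_def gvectors_def fun_eq_iff fun_apply_simps)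
    then show ?thesis using False assms giso_map_zero[OF \<phi>] by simp
  qed (use assms in auto)
  finally show ?thesis .
qed

text \<open>\<open>giso\<close> only asks that each degree component be mapped into the
  corresponding one. Since the map commutes with the projections \<open>gpart\<close>, injectivity
  yields the converse, so the inverse map is graded as well.\<close>

lemma giso_map_reflects_gcomponent:
  assumes \<phi>: "giso_map \<phi> M N" and fin: "finite (Basis M)" and v: "v \<in> gvectors M"
    and "\<phi> v \<in> gcomponent N n"
  shows "v \<in> gcomponent M n"
proof -
  have "\<phi> (gpart M n v) = \<phi> v"
    using giso_map_gpart[OF \<phi> fin v, of n] gpart_eq[OF assms(4), of n] by simp
  moreover have "inj_on \<phi> (gvectors M)" using \<phi> by (auto simp: giso_map_def bij_betw_def)
  moreover have "gpart M n v \<in> gcomponent M n" by (rule gpart_gcomponent[OF v])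
  ultimately show ?thesis
    using v gcomponent_subset by (metis inj_onD subsetD)
qed

lemma giso_map_Top_pow:
  assumes \<phi>: "giso_map \<phi> M N" and "\<And>v. v \<in> gvectors M \<Longrightarrow> Top M v \<in> gvectors M"
    and "v \<in> gvectors M"
  shows "\<phi> ((Top M ^^ k) v) = (Top N ^^ k) (\<phi> v)"
proof -
  have "(Top M ^^ k) v \<in> gvectors M \<and> \<phi> ((Top M ^^ k) v) = (Top N ^^ k) (\<phi> v)"
    by (induction k) (use assms in \<open>auto simp: giso_map_def\<close>)
  then show ?thesis ..
qed

lemma Top_gvectors:
  assumes "graded M" shows "Top M v \<in> gvectors M"
proof -
  have "b' \<in> Basis M" if nz: "Top M v b' \<noteq> 0" for b'
  proof -
    obtain b where "b \<in> Basis M" "v b * Act M b b' \<noteq> 0"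
      using nz unfolding Top_def by (meson sum.not_neutral_contains_not_neutral)
    then show ?thesis using assms by (auto simp: graded_def)
  qed
  then show ?thesis by (auto simp: gvectors_def)
qed

text \<open>For the cyclic module \<open>\<delta>\<^sub>c(-i)\<close> this holds exactly when \<open>(c, i) = (r, j)\<close>.\<close>

definition has_string :: "('k::field, 'b) gmod \<Rightarrow> nat \<Rightarrow> int \<Rightarrow> bool" where
  "has_string M r j \<longleftrightarrow> (\<exists>v\<in>gcomponent M j. (Top M ^^ r) v = 0 \<and>
     (Top M ^^ (r - 1)) v \<notin> (Top M ^^ r) ` gcomponent M (j - 1))"

lemma has_string_giso:
  assumes "giso M N" "graded M"
  shows "has_string M r j \<longleftrightarrow> has_string N r j"
proof -
  obtain \<phi> where \<phi>: "giso_map \<phi> M N" using assms giso_iff by blast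
  have fin: "finite (Basis M)" using assms by (auto simp: graded_def)
  have inj: "inj_on \<phi> (gvectors M)" and surj: "\<phi> ` gvectors M = gvectors N"
    using \<phi> by (auto simp: giso_map_def bij_betw_def)
  have T: "\<phi> ((Top M ^^ k) v) = (Top N ^^ k) (\<phi> v)" "(Top M ^^ k) v \<in> gvectors M"
    if "v \<in> gvectors M" for v k
    using giso_map_Top_pow[OF \<phi> Top_gvectors[OF assms(2)] that] that
    by (simp, cases k) (auto simp: Top_gvectors[OF assms(2)])
  have comp: "gcomponent N n = \<phi> ` gcomponent M n" for n
  proof
    show "\<phi> ` gcomponent M n \<subseteq> gcomponent N n" using \<phi> by (auto simp: giso_map_def)
    show "gcomponent N n \<subseteq> \<phi> ` gcomponent M n"
    proof
      fix w assume w: "w \<in> gcomponent N n"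
      then obtain v where "v \<in> gvectors M" "w = \<phi> v"
        using surj gcomponent_subset[of N n] by blast
      then show "w \<in> \<phi> ` gcomponent M n"
        using giso_map_reflects_gcomponent[OF \<phi> fin] w by blast
    qed
  qed
  have eq0: "(Top N ^^ k) (\<phi> v) = 0 \<longleftrightarrow> (Top M ^^ k) v = 0" if "v \<in> gvectors M" for v k
    using T[OF that] giso_map_zero[OF \<phi>] inj_onD[OF inj] fs.subspace_0[OF gvectors_subspace]
    by metis
  have im: "(Top N ^^ k) (\<phi> v) \<in> (Top N ^^ l) ` \<phi> ` gcomponent M n \<longleftrightarrow>
            (Top M ^^ k) v \<in> (Top M ^^ l) ` gcomponent M n" if v: "v \<in> gvectors M" for v k l n
  proof -
    have "(Top N ^^ l) ` \<phi> ` gcomponent M n = \<phi> ` (Top M ^^ l) ` gcomponent M n"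
      using T(1) gcomponent_subset[of M n] unfolding image_image
      by (intro image_cong) (auto dest!: subsetD)
    moreover have "(Top M ^^ l) ` gcomponent M n \<subseteq> gvectors M"
      using T(2) gcomponent_subset[of M n] by blast
    ultimately show ?thesis
      using T[OF v, of k] inj by (simp flip: T add: inj_on_image_mem_iff v)
  qed
  show ?thesis
    unfolding has_string_def comp bex_simps(7)
    using eq0 im gcomponent_subset[of M j] by (intro bex_cong refl) (simp add: subset_iff)
qed

section \<open>Existence of Krull-Schmidt decompositions\<close>

definition unit_vec :: "'b \<Rightarrow> 'b \<Rightarrow> 'k::field" where
  "unit_vec b = (\<lambda>b'. if b' = b then 1 else 0)"

lemma unit_vec_expansion:
  assumes "finite B" "\<And>b. v b \<noteq> 0 \<Longrightarrow> b \<in> B"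
  shows "v = (\<Sum>b\<in>B. scl (v b) (unit_vec b))"
  using assms by (auto simp: fun_eq_iff sum_fun_apply scl_apply unit_vec_def if_distrib[of "\<lambda>x. _ * x"]
      cong: if_cong)

lemma inj_unit_vec: "inj (unit_vec :: 'b \<Rightarrow> 'b \<Rightarrow> 'k::field)"
  by (rule injI) (metis unit_vec_def zero_neq_one)

lemma independent_unit_vec:
  "finite B \<Longrightarrow> fs.independent (unit_vec ` B :: ('b \<Rightarrow> 'k::field) set)"
proof (rule fs.independent_if_scalars_zero)
  fix f :: "('b \<Rightarrow> 'k) \<Rightarrow> 'k" and x :: "'b \<Rightarrow> 'k"
  assume fin: "finite B" and sum0: "(\<Sum>x\<in>unit_vec ` B. scl (f x) x) = 0" and "x \<in> unit_vec ` B"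
  then obtain b where b: "b \<in> B" "x = unit_vec b" by blast
  have "0 = (\<Sum>c\<in>B. scl (f (unit_vec c)) (unit_vec c)) b"
    using sum0 by (simp add: sum.reindex[OF inj_on_subset[OF inj_unit_vec]] zero_fun_apply)
  also have "\<dots> = f x"
    using fin b by (simp add: sum_fun_apply scl_apply unit_vec_def if_distrib[of "\<lambda>x. _ * x"] cong: if_cong)
  finally show "f x = 0" ..
qed auto

lemma spanning_family_independent:
  fixes E :: "'x \<Rightarrow> 'b \<Rightarrow> 'k::field"
  assumes fin: "finite Z" "finite B" and card: "card Z = card B"
    and span: "unit_vec ` B \<subseteq> fs.span (E ` Z)"
    and zero: "(\<Sum>x\<in>Z. scl (w x) (E x)) = 0" and x: "x \<in> Z"
  shows "w x = 0"
proof (rule ccontr)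
  assume nz: "w x \<noteq> 0"
  have "scl (w x) (E x) + (\<Sum>y\<in>Z - {x}. scl (w y) (E y)) = 0"
    using zero x fin by (simp add: sum.remove)
  then have "scl (w x) (E x) = - (\<Sum>y\<in>Z - {x}. scl (w y) (E y))"
    by (simp add: eq_neg_iff_add_eq_0)
  moreover have "E x = scl (inverse (w x)) (scl (w x) (E x))"
    using nz by (simp add: fs.scale_scale)
  moreover have "- (\<Sum>y\<in>Z - {x}. scl (w y) (E y)) \<in> fs.span (E ` (Z - {x}))"
    by (intro fs.span_neg fs.span_sum fs.span_scale fs.span_base) auto
  ultimately have "E x \<in> fs.span (E ` (Z - {x}))"
    using fs.span_scale by metis
  then have "E ` Z \<subseteq> fs.span (E ` (Z - {x}))"
    by (auto intro: fs.span_base)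
  then have "unit_vec ` B \<subseteq> fs.span (E ` (Z - {x}))"
    using span fs.span_minimal[OF _ fs.subspace_span] by blast
  then have "card (unit_vec ` B :: ('b \<Rightarrow> 'k) set) \<le> card (E ` (Z - {x}))"
    using fs.independent_span_bound[OF _ independent_unit_vec, of "E ` (Z - {x})" B] fin by simp
  also have "\<dots> \<le> card (Z - {x})" by (intro card_image_le) (use fin in auto)
  also have "\<dots> < card B"
    using x fin card by (metis card_Diff1_less)
  finally show False
    by (simp add: card_image[OF inj_on_subset[OF inj_unit_vec]])
qed

text \<open>
  By the count of lengths, the spanning condition makes the vectors \<open>T\<^sup>k v l\<close> a basis of the span of
  \<open>B\<close>, so independence need not be carried along.
\<close>

definition string_system ::
  "('k::field, 'b) gmod \<Rightarrow> 'b set \<Rightarrow> nat set \<Rightarrow> (nat \<Rightarrow> 'b \<Rightarrow> 'k) \<Rightarrow> (nat \<Rightarrow> nat) \<Rightarrow> (nat \<Rightarrow> int) \<Rightarrow> bool"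
  where
  "string_system M B I v c j \<longleftrightarrow> finite I \<and> (\<Sum>l\<in>I. c l) = card B \<and>
     (\<forall>l\<in>I. 0 < c l \<and> v l \<in> gcomponent M (j l) \<and> (Top M ^^ c l) (v l) = 0 \<and> j l \<in> Deg M ` B) \<and>
     unit_vec ` B \<subseteq> fs.span ((\<lambda>(l, k). (Top M ^^ k) (v l)) ` (SIGMA l:I. {..<c l}))"

lemma Top_pow_eq_0_mono:
  assumes "(Top M ^^ m) v = 0" "m \<le> n" shows "(Top M ^^ n) v = 0"
proof -
  have "(Top M ^^ n) v = (Top M ^^ (n - m)) ((Top M ^^ m) v)"
    using assms(2) by (metis comp_apply funpow_add le_add_diff_inverse2)
  then show ?thesis using assms(1) module_hom.zero[OF flinear_pow[OF Top_linear]] by metis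
qed

text \<open>
  A new basis vector \<open>b\<close> of lowest degree \<open>n\<close> is first corrected by strings starting in degree \<open>n\<close> so
  that \<open>T b\<close> is a combination of heads \<open>v l\<close>.  If it is nonzero, \<open>b\<close> extends the
  longest string occurring in it.
\<close>

lemma string_system_extend:
  fixes M :: "('k::field, 'b) gmod"
  assumes M: "graded M" and sys: "string_system M B I v c j"
    and x: "x \<in> Basis M" "x \<notin> B" and B: "B \<subseteq> Basis M"
    and low: "\<And>b. b \<in> B \<Longrightarrow> Deg M x \<le> Deg M b"
    and closed: "\<And>b'. Act M x b' \<noteq> 0 \<Longrightarrow> b' \<in> B"
  shows "\<exists>I v c j. string_system M (insert x B) I v c j"
proof -
  define n where "n = Deg M x"
  define T where "T k = (Top M ^^ k)" for k
  define Z where "Z = (SIGMA l:I. {..<c l})"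
  define E where "E = (\<lambda>(l, k). T k (v l))"
  have finB: "finite B" using M B finite_subset by (auto simp: graded_def)
  have lin: "flinear (T k)" for k unfolding T_def by (intro flinear_pow Top_linear)
  have Tadd: "T k (T l w) = T (k + l) w" for k l w by (simp add: T_def funpow_add)
  have finI: "finite I" and cardI: "(\<Sum>l\<in>I. c l) = card B"
    and str: "\<And>l. l \<in> I \<Longrightarrow> 0 < c l \<and> v l \<in> gcomponent M (j l) \<and> T (c l) (v l) = 0 \<and> j l \<in> Deg M ` B"
    and span: "unit_vec ` B \<subseteq> fs.span (E ` Z)"
    using sys by (auto simp: string_system_def T_def Z_def E_def)
  have finZ: "finite Z" using finI by (simp add: Z_def)
  have low': "n \<le> j l" if "l \<in> I" for l using str[OF that] low by (auto simp: n_def)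
  have Tzero: "T k (v l) = 0" if "l \<in> I" "c l \<le> k" for k l
    using Top_pow_eq_0_mono str that unfolding T_def by blast
  have Tcomp: "T k (v l) \<in> gcomponent M (j l + int k)" if "l \<in> I" for k l
    using Top_pow_gcomponent[OF M] str that unfolding T_def by blast
  define e where "e = (unit_vec x :: 'b \<Rightarrow> 'k)"
  have e: "e \<in> gcomponent M n" using x by (auto simp: e_def unit_vec_def gcomponent_def gvectors_def n_def)
  have Te: "T 1 e \<in> gcomponent M (n + 1)" using Top_gcomponent[OF M e] by (simp add: T_def)
  have "T 1 e b \<noteq> 0 \<Longrightarrow> b \<in> B" for b
    using closed M x(1) by (auto simp: T_def Top_def e_def unit_vec_def graded_def
        if_distrib[of "\<lambda>x. x * _"] cong: if_cong)
  then have "T 1 e = (\<Sum>b\<in>B. scl (T 1 e b) (unit_vec b))"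
    by (intro unit_vec_expansion finB) auto
  then have "T 1 e \<in> fs.span (E ` Z)"
    using span by (metis (no_types, lifting) fs.span_scale fs.span_sum imageI subset_iff)
  moreover have "fs.span (E ` Z) = range (\<lambda>u. \<Sum>y\<in>E ` Z. scl (u y) y)"
    by (rule fs.span_finite) (simp add: finZ)
  ultimately obtain f where f: "T 1 e = (\<Sum>y\<in>E ` Z. scl (f y) y)"
    by auto
  \<comment> \<open>The span gives coefficients per vector, but \<open>E\<close> might take a value
    twice. A set \<open>Y\<close> of representatives turns them into coefficients \<open>w\<close>
    per index.\<close>
  obtain Y where Y: "Y \<subseteq> Z" "inj_on E Y" "E ` Z = E ` Y"
    using subset_image_inj[of "E ` Z" E Z] by auto
  define w where "w = (\<lambda>y. if y \<in> Y then f (E y) else 0)"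
  have "T 1 e = (\<Sum>y\<in>Y. scl (f (E y)) (E y))" using f Y by (simp add: sum.reindex)
  also have "\<dots> = (\<Sum>y\<in>Z. scl (w y) (E y))"
    using Y finZ by (intro sum.mono_neutral_cong_left) (auto simp: w_def)
  finally have w: "T 1 e = (\<Sum>y\<in>Z. scl (w y) (E y))" .
  \<comment> \<open>No head lies below degree \<open>n\<close>, so in degree \<open>n + 1\<close>
    only two kinds of string vectors occur: heads of degree \<open>n + 1\<close> (collected in
    \<open>A 0\<close>) and images under \<open>T\<close> of heads of degree \<open>n\<close>
    (collected in \<open>A 1\<close>).\<close>
  define A where "A k = {l \<in> I. k < c l \<and> j l + int k = n + 1}" for k
  have finA: "finite (A k)" for k using finI by (simp add: A_def)
  have TeA: "T 1 e = (\<Sum>l\<in>A 0. scl (w (l, 0)) (v l)) + (\<Sum>l\<in>A 1. scl (w (l, 1)) (T 1 (v l)))"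
  proof -
    let ?g = "\<lambda>y. scl (w y) (E y)"
    have EZ: "E y \<in> gcomponent M (j (fst y) + int (snd y))" if "y \<in> Z" for y
      using that Tcomp by (auto simp: Z_def E_def)
    have "T 1 e = gpart M (n + 1) (T 1 e)" using gpart_eq[OF Te] by simp
    also have "\<dots> = (\<Sum>y\<in>Z. gpart M (n + 1) (?g y))"
      by (subst w) (rule module_hom.sum[OF gpart_linear])
    also have "\<dots> = (\<Sum>y\<in>Z. if j (fst y) + int (snd y) = n + 1 then ?g y else 0)"
      using gpart_eq[OF EZ] by (intro sum.cong refl) (auto simp: module_hom.scale[OF gpart_linear])
    also have "\<dots> = sum ?g {y\<in>Z. j (fst y) + int (snd y) = n + 1}"
      using finZ by (simp add: sum.inter_filter)
    also have "{y\<in>Z. j (fst y) + int (snd y) = n + 1} = (\<lambda>l. (l, 0)) ` A 0 \<union> (\<lambda>l. (l, 1)) ` A 1"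
    proof -
      have "k = 0 \<or> k = 1" if "l \<in> I" "j l + int k = n + 1" for l k
        using low'[OF that(1)] that(2) by linarith
      then show ?thesis by (fastforce simp: Z_def A_def)
    qed
    also have "sum ?g \<dots> = sum ?g ((\<lambda>l. (l, 0)) ` A 0) + sum ?g ((\<lambda>l. (l, 1)) ` A 1)"
      using finA by (intro sum.union_disjoint) auto
    finally show ?thesis by (simp add: sum.reindex inj_on_def E_def T_def)
  qed
  define \<alpha> where "\<alpha> l = w (l, 0)" for l
  define b where "b = e - (\<Sum>l\<in>A 1. scl (w (l, 1)) (v l))"
  have Tb: "T k (T 1 b) = (\<Sum>l\<in>A 0. scl (\<alpha> l) (T k (v l)))" for k
  proof -
    have "T 1 b = (\<Sum>l\<in>A 0. scl (\<alpha> l) (v l))"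
      unfolding b_def module_hom.diff[OF lin] module_hom.sum[OF lin] module_hom.scale[OF lin]
      by (subst TeA) (simp add: \<alpha>_def)
    then show ?thesis by (simp add: module_hom.sum[OF lin] module_hom.scale[OF lin])
  qed
  have b: "b \<in> gcomponent M n"
    unfolding b_def
    using e str by (intro fs.subspace_diff fs.subspace_sum fs.subspace_scale gcomponent_subspace)
      (auto simp: A_def)
  have spanning: "unit_vec ` insert x B \<subseteq> fs.span Y"
    if bY: "b \<in> fs.span Y" and EY: "E ` Z \<subseteq> fs.span Y" for Y
  proof -
    have "fs.span (E ` Z) \<subseteq> fs.span Y" using fs.span_minimal[OF EY fs.subspace_span] .
    then have "unit_vec ` B \<subseteq> fs.span Y" using span by blast
    moreover have "e = b + (\<Sum>l\<in>A 1. scl (w (l, 1)) (v l))" by (simp add: b_def)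
    moreover have "v l \<in> fs.span Y" if "l \<in> A 1" for l
    proof -
      have "E (l, 0) \<in> E ` Z" using that by (intro imageI) (auto simp: Z_def A_def)
      then show ?thesis using EY by (auto simp: E_def T_def)
    qed
    ultimately show ?thesis
      using bY by (auto simp: e_def[symmetric] intro!: fs.span_add fs.span_sum fs.span_scale)
  qed
  show ?thesis
  proof (cases "\<forall>l\<in>A 0. \<alpha> l = 0")
    case True
    \<comment> \<open>Here \<open>T 1 b = 0\<close>, so \<open>b\<close> is a string of length 1 by
      itself, stored under a fresh index.\<close>
    obtain l where l: "l \<notin> I" using finI ex_new_if_finite infinite_UNIV_nat by blast
    let ?v = "v(l := b)" and ?c = "c(l := 1)" and ?j = "j(l := n)"
    let ?E = "(\<lambda>(l, k). T k (?v l)) ` (SIGMA l:insert l I. {..<?c l})"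
    have "T 1 b = 0" using Tb[of 0] True by (simp add: T_def)
    moreover have "b \<in> ?E"
      by (rule image_eqI[of _ _ "(l, 0)"]) (auto simp: T_def)
    moreover have "E ` Z \<subseteq> ?E"
      using l by (force simp: E_def Z_def)
    then have "E ` Z \<subseteq> fs.span ?E" using fs.span_superset by blast
    moreover have "(\<Sum>i\<in>insert l I. ?c i) = card (insert x B)"
    proof -
      have "(\<Sum>i\<in>I. ?c i) = (\<Sum>i\<in>I. c i)" using l by (intro sum.cong) auto
      then show ?thesis using l finI x finB cardI by simp
    qed
    ultimately have "string_system M (insert x B) (insert l I) ?v ?c ?j"
      unfolding string_system_def
      using finI str b l spanning[of ?E] fs.span_base[of b ?E]
      by (auto simp: T_def n_def)
    then show ?thesis by blast
  next
    case False
    define S where "S = {l \<in> A 0. \<alpha> l \<noteq> 0}"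
    have S: "finite S" "S \<noteq> {}" using False finA by (auto simp: S_def)
    \<comment> \<open>Maximality makes \<open>T (c l)\<close> kill every head that occurs in
      \<open>T 1 b\<close>; hence \<open>b\<close> can head a string of length
      \<open>Suc (c l)\<close> in place of \<open>v l\<close>, and the total length grows by exactly
      one.\<close>
    obtain l where l: "l \<in> S" and max: "\<And>i. i \<in> S \<Longrightarrow> c i \<le> c l"
    proof -
      have "Max (c ` S) \<in> c ` S" using S by (intro Max_in) auto
      then obtain l where "l \<in> S" "c l = Max (c ` S)" by auto
      then show thesis using that S(1) by simp
    qed
    have lI: "l \<in> I" "l \<in> A 0" "\<alpha> l \<noteq> 0" using l by (auto simp: S_def A_def)
    let ?v = "v(l := b)" and ?c = "c(l := Suc (c l))" and ?j = "j(l := n)"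
    let ?E = "(\<lambda>(l, k). T k (?v l)) ` (SIGMA l:I. {..<?c l})"
    have sub: "S \<subseteq> A 0" "S \<subseteq> I" by (auto simp: S_def A_def)
    have TbS: "T k (T 1 b) = (\<Sum>i\<in>S. scl (\<alpha> i) (T k (v i)))" for k
      unfolding Tb using finA by (intro sum.mono_neutral_right) (auto simp: S_def)
    have "T (Suc (c l)) b = T (c l) (T 1 b)" by (simp add: Tadd)
    also have "\<dots> = 0"
      unfolding TbS using sub max Tzero by (intro sum.neutral) (auto simp: subset_iff)
    finally have Tl: "T (Suc (c l)) b = 0" .
    have bE: "T k b \<in> ?E" if "k < Suc (c l)" for k
      using that lI by (intro image_eqI[of _ _ "(l, k)"]) auto
    have iE: "T k (v i) \<in> fs.span ?E" if "i \<in> I" "i \<noteq> l" for i k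
    proof (cases "k < c i")
      case True
      then have "T k (v i) \<in> ?E" using that by (intro image_eqI[of _ _ "(i, k)"]) auto
      then show ?thesis by (rule fs.span_base)
    qed (use Tzero that fs.span_zero in auto)
    \<comment> \<open>The displaced vectors are recovered by solving for \<open>T k (v l)\<close> in
      the expansion of \<open>T (Suc k) b\<close>: the other strings are still present and
      \<open>\<alpha> l\<close> is invertible.\<close>
    have lE: "T k (v l) \<in> fs.span ?E" if "k < c l" for k
    proof -
      have "T (Suc k) b = T k (T 1 b)" by (simp add: Tadd)
      also have "\<dots> = scl (\<alpha> l) (T k (v l)) + (\<Sum>i\<in>S - {l}. scl (\<alpha> i) (T k (v i)))"
        unfolding TbS using S l by (simp add: sum.remove)
      finally have "scl (\<alpha> l) (T k (v l)) = T (Suc k) b - (\<Sum>i\<in>S - {l}. scl (\<alpha> i) (T k (v i)))"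
        by simp
      moreover have "\<dots> \<in> fs.span ?E"
      proof (intro fs.span_diff fs.span_sum fs.span_scale)
        show "T (Suc k) b \<in> fs.span ?E" using bE[of "Suc k"] that by (intro fs.span_base) simp
        show "T k (v i) \<in> fs.span ?E" if "i \<in> S - {l}" for i using that sub by (intro iE) auto
      qed
      ultimately have "scl (inverse (\<alpha> l)) (scl (\<alpha> l) (T k (v l))) \<in> fs.span ?E"
        using fs.span_scale by metis
      then show ?thesis using lI by (simp add: fs.scale_scale)
    qed
    have "E ` Z \<subseteq> fs.span ?E"
      using iE lE by (auto simp: E_def Z_def)
    then have "unit_vec ` insert x B \<subseteq> fs.span ?E"
      using bE[of 0] by (intro spanning fs.span_base) (auto simp: T_def)
    moreover have "(\<Sum>i\<in>I. ?c i) = card (insert x B)"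
    proof -
      have "(\<Sum>i\<in>I. ?c i) = Suc (c l) + (\<Sum>i\<in>I - {l}. ?c i)"
        using finI lI by (simp add: sum.remove)
      also have "(\<Sum>i\<in>I - {l}. ?c i) = (\<Sum>i\<in>I - {l}. c i)" by (rule sum.cong) auto
      also have "Suc (c l) + \<dots> = Suc (\<Sum>i\<in>I. c i)"
        using finI lI by (simp add: sum.remove)
      finally show ?thesis using x finB cardI by simp
    qed
    ultimately have "string_system M (insert x B) I ?v ?c ?j"
      unfolding string_system_def
      using finI str b Tl by (auto simp: T_def n_def simp del: funpow.simps)
    then show ?thesis by blast
  qed
qed

lemma string_system_exists:
  assumes "graded M"
  shows "\<exists>I v c j. string_system M (Basis M) I v c j"
proof -
  have "B \<subseteq> Basis M \<Longrightarrow> (\<And>b b'. b \<in> B \<Longrightarrow> Act M b b' \<noteq> 0 \<Longrightarrow> b' \<in> B) \<Longrightarrow>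
      \<exists>I v c j. string_system M B I v c j" if "finite B" for B
    using that
  \<comment> \<open>Ranking by the negated degree adds basis vectors in order of decreasing degree,
    so \<open>T\<close> maps a new vector into the span of the earlier ones and the part built so
    far is stable under \<open>T\<close>.\<close>
  proof (induction B rule: finite_ranking_induct[where f = "\<lambda>b. - Deg M b"])
    case empty
    show ?case by (rule exI[of _ "{}"]) (simp add: string_system_def)
  next
    case (insert x B)
    show ?case
    proof (cases "x \<in> B")
      case True
      then show ?thesis using insert by (simp add: insert_absorb)
    next
      case False
      have deg: "Deg M b' = Deg M b + 1" if "b \<in> insert x B" "Act M b b' \<noteq> 0" for b b'
        using assms insert.prems that by (auto simp: graded_def)
      have le: "Deg M x \<le> Deg M b" if "b \<in> B" for b using insert.hyps(2)[OF that] by simp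
      have "b' \<in> B" if "b \<in> B" "Act M b b' \<noteq> 0" for b b'
        using insert.prems(2)[of b b'] deg[of b b'] le[of b] that by auto
      then obtain I v c j where "string_system M B I v c j"
        using insert.IH insert.prems(1) by blast
      moreover have "b' \<in> B" if "Act M x b' \<noteq> 0" for b'
        using insert.prems(2)[of x b'] deg[of x b'] that by auto
      ultimately show ?thesis
        using string_system_extend[OF assms _ _ False] insert.prems(1) le by blast
    qed
  qed
  then show ?thesis using assms unfolding graded_def by blast
qed

text \<open>The isomorphism is constructed from the sum of cyclic modules to \<open>M\<close>,
  whereas \<open>KS_decomposition\<close> asks for the opposite direction.\<close>

lemma giso_sym:
  assumes "giso M N" "finite (Basis M)" "\<And>v. Top M v \<in> gvectors M"
  shows "giso N M"
proof -
  obtain \<phi> where \<phi>: "giso_map \<phi> M N" using assms giso_iff by blast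
  define \<psi> where "\<psi> = inv_into (gvectors M) \<phi>"
  have bij: "bij_betw \<phi> (gvectors M) (gvectors N)" using \<phi> by (simp add: giso_map_def)
  have \<psi>: "\<psi> w \<in> gvectors M" "\<phi> (\<psi> w) = w" if "w \<in> gvectors N" for w
    using bij that by (auto simp: \<psi>_def bij_betw_def inv_into_into f_inv_into_f)
  have \<psi>_eq: "\<psi> w = v" if "v \<in> gvectors M" "\<phi> v = w" for v w
    using bij that by (auto simp: \<psi>_def bij_betw_def)
  have "giso_map \<psi> N M"
    unfolding giso_map_def
  proof (intro conjI ballI allI subsetI)
    show "bij_betw \<psi> (gvectors N) (gvectors M)"
      unfolding \<psi>_def using bij by (rule bij_betw_inv_into)
    fix v w assume v: "v \<in> gvectors N" and w: "w \<in> gvectors N"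
    show "\<psi> (v + w) = \<psi> v + \<psi> w"
      using \<phi> \<psi> v w by (intro \<psi>_eq fs.subspace_add gvectors_subspace) (simp_all add: giso_map_def)
  next
    fix c v assume v: "v \<in> gvectors N"
    show "\<psi> (scl c v) = scl c (\<psi> v)"
      using \<phi> \<psi> v by (intro \<psi>_eq fs.subspace_scale gvectors_subspace) (simp_all add: giso_map_def)
  next
    fix v assume v: "v \<in> gvectors N"
    show "\<psi> (Top N v) = Top M (\<psi> v)"
      using \<phi> \<psi> v assms(3) by (intro \<psi>_eq) (simp_all add: giso_map_def)
  next
    fix n v assume "v \<in> \<psi> ` gcomponent N n"
    then obtain w where w: "w \<in> gcomponent N n" "v = \<psi> w" by blast
    then have "w \<in> gvectors N" using gcomponent_subset by blast
    then show "v \<in> gcomponent M n"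
      using giso_map_reflects_gcomponent[OF \<phi> assms(2)] \<psi> w by metis
  qed
  then show ?thesis by (auto simp: giso_iff)
qed

section \<open>Direct sums of cyclic modules\<close>

definition delta_sum :: "(nat \<times> int) list \<Rightarrow> ('k::field, nat \<times> nat) gmod" where
  "delta_sum cs = gdirect_sum (map (\<lambda>(c, j). delta c j) cs)"

lemma Basis_delta_sum: "Basis (delta_sum cs) = (SIGMA p:{..<length cs}. {..<fst (cs ! p)})"
  by (auto simp: delta_sum_def gdirect_sum_def delta_def split: prod.splits)

lemma Deg_delta_sum: "p < length cs \<Longrightarrow> Deg (delta_sum cs) (p, k) = snd (cs ! p) + int k"
  by (auto simp: delta_sum_def gdirect_sum_def delta_def split: prod.splits)

lemma Act_delta_sum: "p < length cs \<Longrightarrow> Act (delta_sum cs) (p, k) y =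
    (if y = (p, Suc k) \<and> Suc k < fst (cs ! p) then 1 else 0)"
  by (cases y) (auto simp: delta_sum_def gdirect_sum_def delta_def split: prod.splits)

lemma graded_delta_sum: "graded (delta_sum cs)"
  by (auto simp: graded_def Basis_delta_sum Deg_delta_sum Act_delta_sum split: if_splits)

lemma Top_unit_vec_delta_sum:
  assumes "p < length cs" "k < fst (cs ! p)"
  shows "Top (delta_sum cs) (unit_vec (p, k)) =
    (if Suc k < fst (cs ! p) then unit_vec (p, Suc k) else 0)"
proof
  fix y
  have "Top (delta_sum cs) (unit_vec (p, k)) y = Act (delta_sum cs) (p, k) y"
    using assms graded_delta_sum[of cs]
    by (simp add: Top_def unit_vec_def graded_def if_distrib[of "\<lambda>x. x * _"] Basis_delta_sum
        cong: if_cong)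
  then show "Top (delta_sum cs) (unit_vec (p, k)) y =
    (if Suc k < fst (cs ! p) then unit_vec (p, Suc k) else 0) y"
    using assms by (auto simp: Act_delta_sum unit_vec_def zero_fun_apply)
qed

lemma Top_delta_sum:
  fixes w :: "nat \<times> nat \<Rightarrow> 'k::field"
  assumes "w \<in> gvectors (delta_sum cs)"
  shows "Top (delta_sum cs) w (p, k) =
    (if p < length cs \<and> k < fst (cs ! p) \<and> 0 < k then w (p, k - 1) else 0)"
proof -
  let ?N = "delta_sum cs :: ('k, nat \<times> nat) gmod"
  have "Top ?N w (p, k) = (\<Sum>y\<in>Basis ?N. if p < length cs \<and> k < fst (cs ! p) \<and> 0 < k \<and> y = (p, k - 1)
      then w y else 0)"
    unfolding Top_def by (intro sum.cong refl) (auto simp: Basis_delta_sum Act_delta_sum split: if_splits)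
  also have "\<dots> = (if p < length cs \<and> k < fst (cs ! p) \<and> 0 < k then w (p, k - 1) else 0)"
  proof (cases "p < length cs \<and> k < fst (cs ! p) \<and> 0 < k")
    case True
    then have "(p, k - 1) \<in> Basis ?N" by (auto simp: Basis_delta_sum)
    moreover have "finite (Basis ?N)" by (simp add: Basis_delta_sum)
    ultimately show ?thesis using True by simp
  next
    case False
    then show ?thesis by (intro trans[OF sum.neutral]) auto
  qed
  finally show ?thesis .
qed

lemma Top_pow_delta_sum:
  assumes "w \<in> gvectors (delta_sum cs)"
  shows "(Top (delta_sum cs) ^^ n) w (p, k) =
    (if p < length cs \<and> k < fst (cs ! p) \<and> n \<le> k then w (p, k - n) else 0)"
proof (induction n arbitrary: k)
  case 0
  then show ?case using assms by (auto simp: gvectors_def Basis_delta_sum)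
next
  case (Suc n)
  have "(Top (delta_sum cs) ^^ n) w \<in> gvectors (delta_sum cs)"
    by (cases n) (auto simp: assms Top_gvectors graded_delta_sum)
  then show ?case
    by (simp add: Top_delta_sum Suc.IH) (auto intro!: arg_cong[of _ _ "\<lambda>x. w (p, x)"])
qed

text \<open>If \<open>(r, j)\<close> occurs, the generator of that summand is a witness:
  \<open>T^(r-1)\<close> moves it to position \<open>r - 1\<close>, a position which no vector in
  the image of \<open>T^r\<close> reaches. Otherwise every \<open>v\<close> killed by
  \<open>T^r\<close> can be shifted back one step without changing the relevant image.\<close>

lemma has_string_delta_sum:
  assumes "0 < r" "\<And>c i. (c, i) \<in> set cs \<Longrightarrow> 0 < c"
  shows "has_string (delta_sum cs :: ('k::field, _) gmod) r j \<longleftrightarrow> (r, j) \<in> set cs"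
proof
  let ?N = "delta_sum cs :: ('k, nat \<times> nat) gmod"
  have vec: "v \<in> gvectors ?N" if "v \<in> gcomponent ?N n" for v n
    using that gcomponent_subset by blast
  {
    assume "(r, j) \<in> set cs"
    then obtain p where p: "p < length cs" "cs ! p = (r, j)" by (metis in_set_conv_nth)
    let ?v = "unit_vec (p, 0) :: nat \<times> nat \<Rightarrow> 'k"
    have v: "?v \<in> gcomponent ?N j"
      using p assms by (auto simp: gcomponent_def gvectors_def unit_vec_def Basis_delta_sum Deg_delta_sum)
    have "(Top ?N ^^ r) ?v = 0"
    proof
      fix y :: "nat \<times> nat"
      show "(Top ?N ^^ r) ?v y = 0 y"
        using p by (cases y) (simp add: Top_pow_delta_sum[OF vec[OF v]] zero_fun_apply, simp add: unit_vec_def)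
    qed
    moreover have "(Top ?N ^^ (r - 1)) ?v (p, r - 1) = 1"
      using p assms by (simp add: Top_pow_delta_sum[OF vec[OF v]], simp add: unit_vec_def)
    moreover have "(Top ?N ^^ r) w (p, r - 1) = 0" if "w \<in> gcomponent ?N (j - 1)" for w
      using p assms by (simp add: Top_pow_delta_sum[OF vec[OF that]])
    ultimately show "has_string ?N r j"
      unfolding has_string_def using v by force
  }
  assume "has_string ?N r j"
  then obtain v where v: "v \<in> gcomponent ?N j" "(Top ?N ^^ r) v = 0"
    and nim: "(Top ?N ^^ (r - 1)) v \<notin> (Top ?N ^^ r) ` gcomponent ?N (j - 1)"
    unfolding has_string_def by blast
  show "(r, j) \<in> set cs"
  proof (rule ccontr)
    assume notin: "(r, j) \<notin> set cs"
    \<comment> \<open>The shift of \<open>v\<close> one position down each string, a candidate for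
      \<open>T w = v\<close>. It loses only the coefficients of \<open>v\<close> at position 0, so
      \<open>T^r w = T^(r-1) v\<close> has to be checked only at position
      \<open>r - 1\<close>.\<close>
    define w where "w = (\<lambda>(p, k). if p < length cs \<and> Suc k < fst (cs ! p) then v (p, Suc k) else 0)"
    have w: "w \<in> gcomponent ?N (j - 1)"
      using v by (fastforce simp: w_def gcomponent_def gvectors_def Basis_delta_sum Deg_delta_sum split: if_splits)
    have "(Top ?N ^^ r) w (p, k) = (Top ?N ^^ (r - 1)) v (p, k)" for p k
    proof (cases "p < length cs \<and> k < fst (cs ! p) \<and> r - 1 \<le> k")
      case pk: True
      show ?thesis
      proof (cases "r \<le> k")
        case True
        then have "Suc (k - r) = k - (r - 1)" "k - (r - 1) < fst (cs ! p)"
          using assms(1) pk by linarith+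
        then show ?thesis
          using pk True assms(1)
          by (simp add: Top_pow_delta_sum[OF vec[OF w]] Top_pow_delta_sum[OF vec[OF v(1)]],
              simp add: w_def)
      next
        case False
        then have k: "k = r - 1" using pk by linarith
        \<comment> \<open>A nonzero coefficient would put the generator of summand \<open>p\<close>
          in degree \<open>j\<close>; \<open>T^r v = 0\<close> bounds the length by
          \<open>r\<close>, and the existence of position \<open>r - 1\<close> gives at least
          \<open>r\<close>. So the summand would be the excluded \<open>(r, j)\<close>.\<close>
        have "v (p, 0) = 0"
        proof (rule ccontr)
          assume nz: "v (p, 0) \<noteq> 0"
          then have "Deg ?N (p, 0) = j" using v unfolding gcomponent_def by blast
          then have deg: "snd (cs ! p) = j" using pk by (simp add: Deg_delta_sum)
          have "(Top ?N ^^ r) v (p, r) = 0" using v by (simp add: zero_fun_apply)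
          then have "fst (cs ! p) \<le> r"
            using nz pk by (auto simp: Top_pow_delta_sum[OF vec[OF v(1)]] split: if_splits)
          then have "cs ! p = (r, j)" using k pk assms(1) deg by (auto simp: prod_eq_iff)
          then show False using notin pk nth_mem by metis
        qed
        then show ?thesis
          using pk k assms(1)
          by (simp add: Top_pow_delta_sum[OF vec[OF w]] Top_pow_delta_sum[OF vec[OF v(1)]])
      qed
    qed (auto simp: Top_pow_delta_sum[OF vec[OF w]] Top_pow_delta_sum[OF vec[OF v(1)]])
    then have "(Top ?N ^^ r) w = (Top ?N ^^ (r - 1)) v" by auto
    then show False using nim w by (metis imageI)
  qed
qed

text \<open>The map sends the basis element \<open>(p, k)\<close> to \<open>T^k\<close> applied to
  the p-th head. The spanning condition makes it surjective; as the lengths add up to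
  \<open>card (Basis M)\<close>, \<open>spanning_family_independent\<close> makes it
  injective.\<close>

lemma KS_decomposition_exists:
  fixes M :: "('k::field, 'b) gmod"
  assumes M: "graded M"
  shows "\<exists>cs. KS_decomposition M cs"
proof -
  obtain I v c j where sys: "string_system M (Basis M) I v c j"
    using string_system_exists[OF M] by blast
  have finI: "finite I" and finM: "finite (Basis M)"
    using sys M by (auto simp: string_system_def graded_def)
  define xs where "xs = sorted_list_of_set I"
  have xs: "distinct xs" "set xs = I" using finI by (auto simp: xs_def)
  define cs where "cs = map (\<lambda>l. (c l, j l)) xs"
  have str: "0 < c (xs ! p)" "v (xs ! p) \<in> gcomponent M (j (xs ! p))"
      "(Top M ^^ c (xs ! p)) (v (xs ! p)) = 0" if "p < length xs" for p
    using sys nth_mem[OF that] xs by (auto simp: string_system_def)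
  have cs: "length cs = length xs" "cs ! p = (c (xs ! p), j (xs ! p))" if "p < length xs" for p
    using that by (auto simp: cs_def)
  let ?N = "delta_sum cs :: ('k, nat \<times> nat) gmod"
  define Z where "Z = Basis ?N"
  define E where "E = (\<lambda>(p, k). (Top M ^^ k) (v (xs ! p)))"
  define \<Phi> where "\<Phi> w = (\<Sum>y\<in>Z. scl (w y) (E y))" for w
  have Z: "Z = (SIGMA p:{..<length xs}. {..<c (xs ! p)})"
    unfolding Z_def Basis_delta_sum using cs by (auto simp: cs_def)
  have finZ: "finite Z" by (simp add: Z)
  have \<Phi>: "flinear \<Phi>"
    by (rule flinearI) (simp_all add: \<Phi>_def plus_fun_apply scl_apply fs.scale_left_distrib sum.distrib
        fs.scale_sum_right)
  have \<Phi>_unit: "\<Phi> (unit_vec y) = E y" if "y \<in> Z" for y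
  proof -
    have "\<Phi> (unit_vec y) = (\<Sum>z\<in>Z. if z = y then E z else 0)"
      unfolding \<Phi>_def by (intro sum.cong) (auto simp: unit_vec_def)
    then show ?thesis using finZ that by simp
  qed
  have unit: "unit_vec y \<in> gvectors ?N" if "y \<in> Z" for y
    using that by (auto simp: unit_vec_def gvectors_def Z_def)
  have expand: "w = (\<Sum>y\<in>Z. scl (w y) (unit_vec y))" if "w \<in> gvectors ?N" for w
    using that by (intro unit_vec_expansion finZ) (auto simp: gvectors_def Z_def)
  have E_comp: "E y \<in> gcomponent M (Deg ?N y)" if "y \<in> Z" for y
    using that str Top_pow_gcomponent[OF M] cs by (auto simp: Z E_def Deg_delta_sum)
  have comp: "\<Phi> w \<in> gcomponent M n" if "w \<in> gcomponent ?N n" for w n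
    unfolding \<Phi>_def
  proof (rule fs.subspace_sum[OF gcomponent_subspace])
    fix y assume "y \<in> Z"
    show "scl (w y) (E y) \<in> gcomponent M n"
    proof (cases "w y = 0")
      case False
      then have "Deg ?N y = n" using that unfolding gcomponent_def by blast
      then show ?thesis
        using E_comp[OF \<open>y \<in> Z\<close>] by (intro fs.subspace_scale gcomponent_subspace) simp
    qed (simp add: fs.subspace_0[OF gcomponent_subspace])
  qed
  have "(\<lambda>(l, k). (Top M ^^ k) (v l)) ` (SIGMA l:I. {..<c l}) \<subseteq> E ` Z"
  proof (rule image_subsetI)
    fix y assume "y \<in> (SIGMA l:I. {..<c l})"
    then obtain p k where "p < length xs" "y = (xs ! p, k)" "k < c (xs ! p)"
      using xs by (auto simp: in_set_conv_nth)
    then show "(\<lambda>(l, k). (Top M ^^ k) (v l)) y \<in> E ` Z"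
      by (intro image_eqI[of _ _ "(p, k)"]) (auto simp: E_def Z)
  qed
  then have span: "unit_vec ` Basis M \<subseteq> fs.span (E ` Z)"
    using sys fs.span_mono unfolding string_system_def by blast
  have card: "card Z = card (Basis M)"
  proof -
    have "card Z = (\<Sum>p<length xs. c (xs ! p))" by (simp add: Z)
    also have "\<dots> = (\<Sum>l\<in>I. c l)"
      using bij_betw_nth[OF xs(1) refl xs(2)[symmetric]] by (rule sum.reindex_bij_betw)
    finally show ?thesis using sys by (simp add: string_system_def)
  qed
  have inj: "inj_on \<Phi> (gvectors ?N)"
  proof (rule inj_onI)
    fix w w' assume w: "w \<in> gvectors ?N" "w' \<in> gvectors ?N" "\<Phi> w = \<Phi> w'"
    have d: "w - w' \<in> gvectors ?N" using w by (intro fs.subspace_diff gvectors_subspace)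
    have "\<Phi> (w - w') = 0" using w by (simp add: module_hom.diff[OF \<Phi>])
    then have "(w - w') y = 0" if "y \<in> Z" for y
      using spanning_family_independent[OF finZ finM card span] that unfolding \<Phi>_def by blast
    then have "w - w' = 0" using d by (auto simp: gvectors_def Z_def fun_eq_iff zero_fun_apply)
    then show "w = w'" by simp
  qed
  have im: "\<Phi> ` gvectors ?N = gvectors M"
  proof
    show "\<Phi> ` gvectors ?N \<subseteq> gvectors M"
      unfolding \<Phi>_def using E_comp gcomponent_subset
      by (auto intro!: fs.subspace_sum fs.subspace_scale gvectors_subspace) blast
    have sub: "fs.subspace (\<Phi> ` gvectors ?N)"
      by (rule module_hom.subspace_image[OF \<Phi> gvectors_subspace])
    have "E ` Z \<subseteq> \<Phi> ` gvectors ?N" using \<Phi>_unit unit by (metis image_eqI image_subsetI)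
    then have units: "unit_vec ` Basis M \<subseteq> \<Phi> ` gvectors ?N"
      using span fs.span_minimal[OF _ sub] by blast
    show "gvectors M \<subseteq> \<Phi> ` gvectors ?N"
    proof
      fix x assume "x \<in> gvectors M"
      then have "x = (\<Sum>b\<in>Basis M. scl (x b) (unit_vec b))"
        by (intro unit_vec_expansion finM) (auto simp: gvectors_def)
      also have "\<dots> \<in> \<Phi> ` gvectors ?N"
        using units by (intro fs.subspace_sum[OF sub] fs.subspace_scale[OF sub]) auto
      finally show "x \<in> \<Phi> ` gvectors ?N" .
    qed
  qed
  have Top_unit: "\<Phi> (Top ?N (unit_vec y)) = Top M (\<Phi> (unit_vec y))" if yZ: "y \<in> Z" for y
  proof -
    obtain p k where y: "y = (p, k)" "p < length xs" "k < c (xs ! p)" using yZ by (auto simp: Z)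
    have "Top M (E y) = (if Suc k < c (xs ! p) then E (p, Suc k) else 0)"
    proof (cases "Suc k < c (xs ! p)")
      case False
      then have "Suc k = c (xs ! p)" using y by linarith
      then have "(Top M ^^ Suc k) (v (xs ! p)) = 0" using str(3)[OF y(2)] by simp
      then show ?thesis using False y by (simp add: E_def)
    qed (use y in \<open>simp add: E_def\<close>)
    moreover have "Top ?N (unit_vec y) = (if Suc k < c (xs ! p) then unit_vec (p, Suc k) else 0)"
      using y cs Top_unit_vec_delta_sum[of p cs k] by simp
    moreover have "(p, Suc k) \<in> Z" if "Suc k < c (xs ! p)" using that y by (simp add: Z)
    ultimately show ?thesis
      using yZ by (simp add: \<Phi>_unit module_hom.zero[OF \<Phi>])
  qed
  have Top: "\<Phi> (Top ?N w) = Top M (\<Phi> w)" if "w \<in> gvectors ?N" for w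
  proof -
    have "\<Phi> (Top ?N (\<Sum>y\<in>Z. scl (w y) (unit_vec y))) = Top M (\<Phi> (\<Sum>y\<in>Z. scl (w y) (unit_vec y)))"
      by (simp add: module_hom.sum[OF \<Phi>] module_hom.sum[OF Top_linear] module_hom.scale[OF \<Phi>]
          module_hom.scale[OF Top_linear] Top_unit)
    then show ?thesis using expand[OF that] by simp
  qed
  have "giso_map \<Phi> ?N M"
    unfolding giso_map_def using inj im comp Top
    by (auto simp: bij_betw_def module_hom.add[OF \<Phi>] module_hom.scale[OF \<Phi>])
  then have "giso M ?N"
    using giso_sym[of ?N M] graded_delta_sum[of cs] Top_gvectors[OF graded_delta_sum]
    by (auto simp: giso_iff graded_def)
  moreover have "\<forall>(c, j) \<in> set cs. 0 < c"
    using sys xs by (auto simp: cs_def string_system_def)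
  ultimately show ?thesis unfolding KS_decomposition_def delta_sum_def by blast
qed

text \<open>By invariance, \<open>has_string\<close> can be read off from any decomposition
  whatsoever; the existence of one gives the direction from \<open>has_string\<close> to a
  summand.\<close>

lemma delta_summand_iff:
  assumes "graded M" "0 < r"
  shows "delta_summand r j M \<longleftrightarrow> has_string M r j"
proof -
  have "(r, j) \<in> set cs \<longleftrightarrow> has_string M r j" if "KS_decomposition M cs" for cs
  proof -
    have "giso M (delta_sum cs)" "\<And>c i. (c, i) \<in> set cs \<Longrightarrow> 0 < c"
      using that by (auto simp: KS_decomposition_def delta_sum_def)
    then show ?thesis
      using has_string_giso[OF _ assms(1)] has_string_delta_sum[OF assms(2)] by metis
  qed
  then show ?thesis
    using KS_decomposition_exists[OF assms(1)] unfolding delta_summand_def by blast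
qed

section \<open>Components of \<open>D\<^sup>dU \<otimes> S\<close> and the tensor product\<close>

lemma omega_add: "omega X1 X2 (f + g) = omega X1 X2 f + omega X1 X2 g"
  and omega_diff: "omega X1 X2 (f - g) = omega X1 X2 f - omega X1 X2 g"
  and omega_scale: "omega X1 X2 (\<lambda>i j. s * f i j) = (\<lambda>i j. s * omega X1 X2 f i j)"
  and omega_zero: "omega X1 X2 0 = 0"
  by (simp_all add: omega_def fun_eq_iff plus_fun_apply minus_fun_apply zero_fun_apply algebra_simps)

lemma omega_pow_add: "(omega X1 X2 ^^ n) (f + g) = (omega X1 X2 ^^ n) f + (omega X1 X2 ^^ n) g"
  by (induction n) (simp_all add: omega_add)

lemma omega_pow_diff: "(omega X1 X2 ^^ n) (f - g) = (omega X1 X2 ^^ n) f - (omega X1 X2 ^^ n) g"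
  by (induction n) (simp_all add: omega_diff)

lemma omega_pow_scale:
  "(omega X1 X2 ^^ n) (\<lambda>i j. s * f i j) = (\<lambda>i j. s * (omega X1 X2 ^^ n) f i j)"
  by (induction n) (simp_all add: omega_scale)

lemma omega_pow_zero: "(omega X1 X2 ^^ n) 0 = 0"
  by (induction n) (simp_all add: omega_zero)

lemma omega_DU: "f \<in> DU d \<Longrightarrow> omega X1 X2 f \<in> DU (d - 1)"
proof -
  assume f: "f \<in> DU d"
  have "int (i + j) = d - 1" if nz: "omega X1 X2 f i j \<noteq> 0" for i j
  proof -
    have "f (Suc i) j \<noteq> 0 \<or> f i (Suc j) \<noteq> 0" using nz by (auto simp: omega_def)
    then have "int (Suc i + j) = d \<or> int (i + Suc j) = d" using f unfolding DU_def by blast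
    then show ?thesis by auto
  qed
  then show ?thesis by (simp add: DU_def)
qed

lemma omega_pow_DU: "f \<in> DU d \<Longrightarrow> (omega X1 X2 ^^ n) f \<in> DU (d - int n)"
proof (induction n)
  case (Suc n)
  then show ?case using omega_DU[of "(omega X1 X2 ^^ n) f" "d - int n"] by (simp add: algebra_simps)
qed simp

lemma DU_diff: "f \<in> DU d \<Longrightarrow> g \<in> DU d \<Longrightarrow> f - g \<in> DU d" for f g :: "nat \<Rightarrow> nat \<Rightarrow> 'a::group_add"
  unfolding DU_def by (auto simp: minus_fun_apply) (metis diff_self)

lemma DU_scale: "f \<in> DU d \<Longrightarrow> (\<lambda>i j. s * f i j) \<in> DU d" for s :: "'a::mult_zero"
  by (auto simp: DU_def) (metis mult_zero_right)

lemma DU_neg: "f \<in> DU d \<Longrightarrow> d < 0 \<Longrightarrow> f = (0 :: nat \<Rightarrow> nat \<Rightarrow> 'a::zero)"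
  by (auto simp: DU_def fun_eq_iff zero_fun_apply)

text \<open>
  The matrices of \<open>\<omega>\<close> between the components of bidegree \<open>(a-1,b-1)\<close> do not involve \<open>x\<^sub>1\<close> and \<open>x\<^sub>2\<close>:
  such a component is \<open>DU_box\<close>, with the coefficient of \<open>x\<^sub>1\<^sup>(\<^sup>i\<^sup>)x\<^sub>2\<^sup>(\<^sup>j\<^sup>)\<close> multiplying
  \<open>x\<^sub>1\<^sup>a\<^sup>-\<^sup>1\<^sup>-\<^sup>i x\<^sub>2\<^sup>b\<^sup>-\<^sup>1\<^sup>-\<^sup>j\<close>, and \<open>\<omega>\<close> is \<open>omega 1 1\<close>.
\<close>

definition box :: "nat \<Rightarrow> nat \<Rightarrow> (nat \<Rightarrow> nat \<Rightarrow> 'a::zero) set" where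
  "box a b = {c. \<forall>i j. c i j \<noteq> 0 \<longrightarrow> i < a \<and> j < b}"

abbreviation omega1 :: "(nat \<Rightarrow> nat \<Rightarrow> 'k) \<Rightarrow> nat \<Rightarrow> nat \<Rightarrow> 'k::comm_ring_1" where
  "omega1 \<equiv> omega 1 1"

definition DU_box :: "int \<Rightarrow> nat \<Rightarrow> nat \<Rightarrow> (nat \<Rightarrow> nat \<Rightarrow> 'a::zero) set" where
  "DU_box d a b = DU d \<inter> box a b"

lemma omega1_box: "c \<in> box a b \<Longrightarrow> omega1 c \<in> box a b"
proof -
  assume c: "c \<in> box a b"
  have "i < a \<and> j < b" if nz: "omega1 c i j \<noteq> 0" for i j
  proof -
    have "c (Suc i) j \<noteq> 0 \<or> c i (Suc j) \<noteq> 0" using nz by (auto simp: omega_def)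
    then show ?thesis using c unfolding box_def by fastforce
  qed
  then show ?thesis by (simp add: box_def)
qed

lemma omega1_pow_box: "c \<in> box a b \<Longrightarrow> (omega1 ^^ n) c \<in> box a b"
  by (induction n) (simp_all add: omega1_box)

lemma omega1_pow_DU_box: "c \<in> DU_box d a b \<Longrightarrow> (omega1 ^^ n) c \<in> DU_box (d - int n) a b"
  by (simp add: DU_box_def omega1_pow_box omega_pow_DU)

lemma DU_box_diff: "f \<in> DU_box d a b \<Longrightarrow> g \<in> DU_box d a b \<Longrightarrow> f - g \<in> DU_box d a b"
  for f g :: "nat \<Rightarrow> nat \<Rightarrow> 'a::group_add"
  unfolding DU_box_def box_def using DU_diff[of f d g]
  by (auto simp: minus_fun_apply) (metis diff_self)+

lemma DU_box_scale: "f \<in> DU_box d a b \<Longrightarrow> (\<lambda>i j. s * f i j) \<in> DU_box d a b" for s :: "'a::mult_zero"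
  by (auto simp: DU_box_def box_def DU_scale) (metis mult_zero_right)+

lemma zero_DU_box: "0 \<in> DU_box d a b"
  by (simp add: DU_box_def DU_def box_def zero_fun_apply)

text \<open>The common form of all three conditions. It is \<open>has_string\<close> for the tensor
  product after reversal of the basis: a monomial of degree n becomes an array entry of total index
  \<open>a + b - 2 - n\<close>, so for \<open>d = a + b - 1 - j\<close> the degrees \<open>j\<close>
  and \<open>j - 1\<close> turn into \<open>d - 1\<close> and \<open>d\<close>. The type argument
  fixes the field, which the numerical arguments do not determine.\<close>

definition string_class :: "'k::field itself \<Rightarrow> nat \<Rightarrow> nat \<Rightarrow> int \<Rightarrow> nat \<Rightarrow> bool" where
  "string_class t a b d r \<longleftrightarrow> (\<exists>c\<in>DU_box (d - 1) a b :: (nat \<Rightarrow> nat \<Rightarrow> 'k) set.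
     (omega1 ^^ r) c = 0 \<and> (omega1 ^^ (r - 1)) c \<notin> (omega1 ^^ r) ` DU_box d a b)"

text \<open>\<open>\<delta>\<^sub>a\<delta>\<^sub>b\<close> is \<open>k[x,y]/(x\<^sup>a,y\<^sup>b)\<close> with \<open>T = x + y\<close>, which is self-dual by reversal of the monomial basis.\<close>

definition box_to_tensor :: "nat \<Rightarrow> nat \<Rightarrow> (nat \<Rightarrow> nat \<Rightarrow> 'k::field) \<Rightarrow> nat \<times> nat \<Rightarrow> 'k" where
  "box_to_tensor a b c = (\<lambda>(p, q). if p < a \<and> q < b then c (a - 1 - p) (b - 1 - q) else 0)"

lemma graded_tensor: "graded (gtensor (delta a 0) (delta b 0))"
  by (auto simp: graded_def gtensor_def delta_def split: if_splits)

lemma Top_tensor: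
  fixes v :: "nat \<times> nat \<Rightarrow> 'k::field"
  shows "Top (gtensor (delta a 0) (delta b 0)) v (p, q) =
    (if p < a \<and> q < b then (if 0 < p then v (p - 1, q) else 0) + (if 0 < q then v (p, q - 1) else 0) else 0)"
proof -
  let ?B = "{..<a} \<times> {..<b}"
  let ?P = "0 < p \<and> p < a \<and> q < b" and ?Q = "0 < q \<and> p < a \<and> q < b"
  have "Top (gtensor (delta a 0) (delta b 0)) v (p, q) =
    (\<Sum>y\<in>?B. (if y = (p - 1, q) then if ?P then v y else 0 else 0) +
             (if y = (p, q - 1) then if ?Q then v y else 0 else 0))"
    unfolding Top_def gtensor_def delta_def
    by (simp, intro sum.cong refl) (auto split: if_splits)
  also have "\<dots> = (if ?P then v (p - 1, q) else 0) + (if ?Q then v (p, q - 1) else 0)"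
    by (auto simp: sum.distrib)
  finally show ?thesis by auto
qed

text \<open>Reversal turns the raising of exponents by \<open>x + y\<close> into the lowering of
  indices by \<open>omega1\<close>. At the edge \<open>p = 0\<close>, where nothing arrives, the
  array is evaluated at index \<open>a\<close>, outside the box; likewise for
  \<open>q\<close>.\<close>

lemma Top_box_to_tensor:
  assumes "c \<in> box a b"
  shows "Top (gtensor (delta a 0) (delta b 0)) (box_to_tensor a b c) = box_to_tensor a b (omega1 c)"
proof
  fix y :: "nat \<times> nat"
  obtain p q where y: "y = (p, q)" by (cases y)
  have 1: "(if 0 < p then box_to_tensor a b c (p - 1, q) else 0) = c (Suc (a - 1 - p)) (b - 1 - q)"
    if "p < a" "q < b"
  proof (cases "p = 0")
    case True
    then have "c (Suc (a - 1 - p)) (b - 1 - q) = 0" using assms that by (auto simp: box_def)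
    then show ?thesis using True by simp
  next
    case False
    then have "a - 1 - (p - 1) = Suc (a - 1 - p)" using that by linarith
    then show ?thesis using False that by (simp add: box_to_tensor_def less_imp_diff_less)
  qed
  have 2: "(if 0 < q then box_to_tensor a b c (p, q - 1) else 0) = c (a - 1 - p) (Suc (b - 1 - q))"
    if "p < a" "q < b"
  proof (cases "q = 0")
    case True
    then have "c (a - 1 - p) (Suc (b - 1 - q)) = 0" using assms that by (auto simp: box_def)
    then show ?thesis using True by simp
  next
    case False
    then have "b - 1 - (q - 1) = Suc (b - 1 - q)" using that by linarith
    then show ?thesis using False that by (simp add: box_to_tensor_def less_imp_diff_less)
  qed
  show "Top (gtensor (delta a 0) (delta b 0)) (box_to_tensor a b c) y = box_to_tensor a b (omega1 c) y"
    unfolding y Top_tensor using 1 2 by (simp add: box_to_tensor_def omega_def)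
qed

lemma Top_pow_box_to_tensor:
  assumes "c \<in> box a b"
  shows "(Top (gtensor (delta a 0) (delta b 0)) ^^ n) (box_to_tensor a b c) =
    box_to_tensor a b ((omega1 ^^ n) c)"
  by (induction n) (simp_all add: Top_box_to_tensor omega1_pow_box assms)

lemma inj_box_to_tensor: "inj_on (box_to_tensor a b) (box a b)"
proof (rule inj_onI, intro ext)
  fix c c' :: "nat \<Rightarrow> nat \<Rightarrow> 'k::field" and i j
  assume c: "c \<in> box a b" "c' \<in> box a b" and eq: "box_to_tensor a b c = box_to_tensor a b c'"
  show "c i j = c' i j"
  proof (cases "i < a \<and> j < b")
    case True
    then show ?thesis
      using fun_cong[OF eq, of "(a - 1 - i, b - 1 - j)"] by (simp add: box_to_tensor_def)
  next
    case False
    then have "c i j = 0" "c' i j = 0" using c by (auto simp: box_def)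
    then show ?thesis by simp
  qed
qed

lemma gcomponent_tensor:
  "gcomponent (gtensor (delta a 0) (delta b 0)) n =
    box_to_tensor a b ` (DU_box (int a + int b - 2 - n) a b :: (nat \<Rightarrow> nat \<Rightarrow> 'k::field) set)"
  (is "gcomponent ?M n = _")
proof
  show "box_to_tensor a b ` DU_box (int a + int b - 2 - n) a b \<subseteq> gcomponent ?M n"
    by (auto simp: gcomponent_def gvectors_def box_to_tensor_def gtensor_def delta_def DU_box_def DU_def
        split: if_splits) force
  show "gcomponent ?M n \<subseteq> box_to_tensor a b ` DU_box (int a + int b - 2 - n) a b"
  proof
    fix v :: "nat \<times> nat \<Rightarrow> 'k" assume v: "v \<in> gcomponent ?M n"
    define c where "c = (\<lambda>i j. if i < a \<and> j < b then v (a - 1 - i, b - 1 - j) else 0)"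
    have supp: "p < a \<and> q < b \<and> int p + int q = n" if "v (p, q) \<noteq> 0" for p q
      using v that by (auto simp: gcomponent_def gvectors_def gtensor_def delta_def)
    have "int (i + j) = int a + int b - 2 - n" if "c i j \<noteq> 0" for i j
    proof -
      have "i < a" "j < b" "v (a - 1 - i, b - 1 - j) \<noteq> 0"
        using that by (auto simp: c_def split: if_splits)
      then show ?thesis using supp[of "a - 1 - i" "b - 1 - j"] by simp
    qed
    then have "c \<in> DU_box (int a + int b - 2 - n) a b"
      by (auto simp: DU_box_def DU_def box_def c_def)
    moreover have "v = box_to_tensor a b c"
    proof
      fix y :: "nat \<times> nat"
      obtain p q where "y = (p, q)" by (cases y)
      then show "v y = box_to_tensor a b c y"
        using supp[of p q] by (cases "v (p, q) = 0") (auto simp: box_to_tensor_def c_def)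
    qed
    ultimately show "v \<in> box_to_tensor a b ` DU_box (int a + int b - 2 - n) a b" by blast
  qed
qed

lemma has_string_tensor:
  assumes d: "d = int a + int b - 1 - j"
  shows "has_string (gtensor (delta a 0) (delta b 0) :: ('k::field, nat \<times> nat) gmod) r j \<longleftrightarrow>
    string_class TYPE('k) a b d r"
proof -
  let ?M = "gtensor (delta a 0) (delta b 0) :: ('k, nat \<times> nat) gmod"
  have box: "c \<in> box a b" if "c \<in> DU_box n a b" for c :: "nat \<Rightarrow> nat \<Rightarrow> 'k" and n
    using that by (simp add: DU_box_def)
  have eq0: "(Top ?M ^^ n) (box_to_tensor a b c) = 0 \<longleftrightarrow> (omega1 ^^ n) c = 0"
    if "c \<in> box a b" for c n
  proof -
    have "box_to_tensor a b (0 :: nat \<Rightarrow> nat \<Rightarrow> 'k) = 0"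
      by (auto simp: box_to_tensor_def fun_eq_iff zero_fun_apply)
    moreover have "0 \<in> box a b" by (simp add: box_def zero_fun_apply)
    ultimately show ?thesis
      using inj_on_eq_iff[OF inj_box_to_tensor omega1_pow_box[OF that, of n], of 0] that
      by (simp add: Top_pow_box_to_tensor)
  qed
  have im: "(Top ?M ^^ k) (box_to_tensor a b c) \<in> (Top ?M ^^ l) ` box_to_tensor a b ` DU_box n a b \<longleftrightarrow>
      (omega1 ^^ k) c \<in> (omega1 ^^ l) ` DU_box n a b" if c: "c \<in> box a b" for c k l n
  proof -
    have "(Top ?M ^^ l) ` box_to_tensor a b ` DU_box n a b =
        box_to_tensor a b ` (omega1 ^^ l) ` DU_box n a b"
      unfolding image_image using box by (intro image_cong) (auto simp: Top_pow_box_to_tensor)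
    moreover have "(omega1 ^^ l) ` DU_box n a b \<subseteq> (box a b :: (nat \<Rightarrow> nat \<Rightarrow> 'k) set)"
      using box omega1_pow_box by blast
    ultimately show ?thesis
      using c inj_on_image_mem_iff[OF inj_box_to_tensor omega1_pow_box[OF c]]
      by (simp add: Top_pow_box_to_tensor)
  qed
  have deg: "int a + int b - 2 - j = d - 1" "int a + int b - 2 - (j - 1) = d"
    using d by simp_all
  show ?thesis
    unfolding has_string_def gcomponent_tensor string_class_def deg bex_simps(7)
    using eq0 im box by (intro bex_cong refl) simp
qed

text \<open>If \<open>h\<close> is killed by \<open>omega1^r\<close> and
  \<open>omega1^(r-1) h = omega1^r f\<close>, then \<open>f\<close> is killed by
  \<open>omega1^(r+1)\<close> and \<open>g = omega1 f - h\<close> by \<open>omega1^(r-1)\<close>.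
  This is a preimage of \<open>h\<close> under \<open>beta\<close>, and the argument
  reverses.\<close>

lemma string_class_iff_cokernel:
  assumes "0 < r"
  shows "string_class TYPE('k::field) a b d r \<longleftrightarrow>
    \<not> (\<forall>h\<in>DU_box (d - 1) a b :: (nat \<Rightarrow> nat \<Rightarrow> 'k) set. (omega1 ^^ r) h = 0 \<longrightarrow>
        (\<exists>f\<in>DU_box d a b. (omega1 ^^ (r + 1)) f = 0 \<and>
          (\<exists>g\<in>DU_box (d - 1) a b. (omega1 ^^ (r - 1)) g = 0 \<and> h = omega1 f - g)))"
proof -
  obtain s where r: "r = Suc s" using assms by (cases r) auto
  have "(omega1 ^^ (r - 1)) h \<in> (omega1 ^^ r) ` DU_box d a b \<longleftrightarrow>
      (\<exists>f\<in>DU_box d a b. (omega1 ^^ (r + 1)) f = 0 \<and>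
          (\<exists>g\<in>DU_box (d - 1) a b. (omega1 ^^ (r - 1)) g = 0 \<and> h = omega1 f - g))"
    if h: "h \<in> DU_box (d - 1) a b" "(omega1 ^^ r) h = 0" for h :: "nat \<Rightarrow> nat \<Rightarrow> 'k"
  proof
    assume "(omega1 ^^ (r - 1)) h \<in> (omega1 ^^ r) ` DU_box d a b"
    then obtain f where f: "f \<in> DU_box d a b" "(omega1 ^^ s) h = (omega1 ^^ r) f" by (auto simp: r)
    have "(omega1 ^^ (r + 1)) f = omega1 ((omega1 ^^ r) f)" by simp
    also have "\<dots> = (omega1 ^^ r) h" using f by (simp add: r)
    finally have "(omega1 ^^ (r + 1)) f = 0" using h by simp
    moreover have "omega1 f - h \<in> DU_box (d - 1) a b"
      using DU_box_diff omega1_pow_DU_box[OF f(1), of 1] h by simp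
    moreover have "(omega1 ^^ s) (omega1 f - h) = 0"
      unfolding omega_pow_diff f(2) by (simp add: r funpow_swap1)
    ultimately show "\<exists>f\<in>DU_box d a b. (omega1 ^^ (r + 1)) f = 0 \<and>
          (\<exists>g\<in>DU_box (d - 1) a b. (omega1 ^^ (r - 1)) g = 0 \<and> h = omega1 f - g)"
      using f(1) by (intro bexI[of _ f] conjI bexI[of _ "omega1 f - h"]) (simp_all add: r)
  next
    assume "\<exists>f\<in>DU_box d a b. (omega1 ^^ (r + 1)) f = 0 \<and>
          (\<exists>g\<in>DU_box (d - 1) a b. (omega1 ^^ (r - 1)) g = 0 \<and> h = omega1 f - g)"
    then obtain f g where f: "f \<in> DU_box d a b" "(omega1 ^^ s) g = 0" "h = omega1 f - g"
      by (auto simp: r)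
    have "(omega1 ^^ s) h = (omega1 ^^ r) f"
      unfolding f(3) omega_pow_diff f(2) by (simp add: r funpow_swap1)
    then show "(omega1 ^^ (r - 1)) h \<in> (omega1 ^^ r) ` DU_box d a b" using f(1) by (auto simp: r)
  qed
  then show ?thesis unfolding string_class_def by blast
qed

text \<open>The coefficients of the generator of the kernel of \<open>omega\<close>: the equation
  \<open>omega1 c = 0\<close> reads \<open>c (i+1) j = - c i (j+1)\<close>, so signs alternate along
  the antidiagonal.\<close>

definition alt :: "nat \<Rightarrow> nat \<Rightarrow> nat \<Rightarrow> 'a::comm_ring_1" where
  "alt m = (\<lambda>i j. if i + j = m then (-1) ^ i else 0)"

lemma omega1_alt: "omega1 (alt m) = 0"
  by (auto simp: omega_def alt_def fun_eq_iff zero_fun_apply)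

lemma omega1_kernel:
  fixes c :: "nat \<Rightarrow> nat \<Rightarrow> 'k::field"
  assumes c: "c \<in> DU (int m)" and ker: "omega1 c = 0"
  shows "c = (\<lambda>i j. c 0 m * alt m i j)"
proof -
  have rec: "c (Suc i) j = - c i (Suc j)" for i j
    using fun_cong[OF fun_cong[OF ker], of i j]
    by (simp add: omega_def zero_fun_apply eq_neg_iff_add_eq_0)
  have "c i (m - i) = (-1) ^ i * c 0 m" if "i \<le> m" for i
    using that
  proof (induction i)
    case (Suc i)
    then have "m - i = Suc (m - Suc i)" by linarith
    then show ?case using Suc rec[of i "m - Suc i"] by simp
  qed simp
  then have "c i j = (-1) ^ i * c 0 m" if "i + j = m" for i j
    using that by (metis add_diff_cancel_left' le_add1)
  moreover have "c i j = 0" if "i + j \<noteq> m" for i j using c that unfolding DU_def by force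
  ultimately show ?thesis
    by (intro ext) (metis (no_types, lifting) alt_def mult.commute mult_zero_right)
qed

text \<open>If \<open>omega1^r c = 0\<close>, then \<open>omega1^(r-1) c\<close> is in the kernel of
  \<open>omega1\<close> and has degree \<open>m = d - r\<close>, hence is a multiple of
  \<open>alt m\<close>. A failure of membership in the image means a nonzero multiple, which can be
  scaled to \<open>alt m\<close>.\<close>

lemma string_class_iff_alt:
  assumes r: "0 < r" and d: "d = int m + int r"
  shows "string_class TYPE('k::field) a b d r \<longleftrightarrow> m < a \<and> m < b \<and>
    (alt m :: nat \<Rightarrow> nat \<Rightarrow> 'k) \<in> (omega1 ^^ (r - 1)) ` DU_box (d - 1) a b \<and>
    (alt m :: nat \<Rightarrow> nat \<Rightarrow> 'k) \<notin> (omega1 ^^ r) ` DU_box d a b"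
proof -
  obtain s where s: "r = Suc s" using assms by (cases r) auto
  let ?alt = "alt m :: nat \<Rightarrow> nat \<Rightarrow> 'k"
  show ?thesis
  proof
    assume "string_class TYPE('k) a b d r"
    then obtain c :: "nat \<Rightarrow> nat \<Rightarrow> 'k" where c: "c \<in> DU_box (d - 1) a b" "(omega1 ^^ r) c = 0"
      and nim: "(omega1 ^^ s) c \<notin> (omega1 ^^ r) ` DU_box d a b"
      by (auto simp: string_class_def s)
    define t where "t = (omega1 ^^ s) c"
    have t: "t \<in> DU_box (int m) a b"
      using omega1_pow_DU_box[OF c(1), of s] d s by (simp add: t_def)
    have "omega1 t = 0" using c by (simp add: t_def s)
    then have t_eq: "t = (\<lambda>i j. t 0 m * alt m i j)"
      using omega1_kernel t unfolding DU_box_def by blast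
    have nz: "t 0 m \<noteq> 0"
    proof
      assume "t 0 m = 0"
      then have "t = 0" using t_eq by (simp add: fun_eq_iff zero_fun_apply)
      then have "t = (omega1 ^^ r) 0" by (simp add: omega_pow_zero)
      then show False using nim zero_DU_box unfolding t_def by blast
    qed
    \<comment> \<open>Both ends of the antidiagonal, \<open>(0, m)\<close> and
      \<open>(m, 0)\<close>, carry nonzero entries, which forces \<open>m < b\<close> and
      \<open>m < a\<close>.\<close>
    then have "t m 0 \<noteq> 0" by (subst t_eq) (simp add: alt_def)
    then have m: "m < a" "m < b" using t nz by (auto simp: DU_box_def box_def)
    have alt_eq: "?alt = (\<lambda>i j. inverse (t 0 m) * t i j)"
      by (subst t_eq) (simp add: nz fun_eq_iff)
    have "?alt = (omega1 ^^ s) (\<lambda>i j. inverse (t 0 m) * c i j)"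
      unfolding omega_pow_scale t_def[symmetric] by (rule alt_eq)
    then have "?alt \<in> (omega1 ^^ s) ` DU_box (d - 1) a b"
      using imageI[OF DU_box_scale[OF c(1)], of "omega1 ^^ s" "inverse (t 0 m)"] by simp
    then have im: "?alt \<in> (omega1 ^^ (r - 1)) ` DU_box (d - 1) a b" by (simp add: s)
    have "?alt \<notin> (omega1 ^^ r) ` DU_box d a b"
    proof
      assume "?alt \<in> (omega1 ^^ r) ` DU_box d a b"
      then obtain f where f: "f \<in> DU_box d a b" "?alt = (omega1 ^^ r) f" by blast
      have "t = (omega1 ^^ r) (\<lambda>i j. t 0 m * f i j)"
        unfolding omega_pow_scale f(2)[symmetric] by (rule t_eq)
      then show False using nim DU_box_scale[OF f(1)] unfolding t_def by blast
    qed
    then show "m < a \<and> m < b \<and> ?alt \<in> (omega1 ^^ (r - 1)) ` DU_box (d - 1) a b \<and>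
        ?alt \<notin> (omega1 ^^ r) ` DU_box d a b" using m im by blast
  next
    assume "m < a \<and> m < b \<and> ?alt \<in> (omega1 ^^ (r - 1)) ` DU_box (d - 1) a b \<and>
        ?alt \<notin> (omega1 ^^ r) ` DU_box d a b"
    then obtain c :: "nat \<Rightarrow> nat \<Rightarrow> 'k" where c: "c \<in> DU_box (d - 1) a b" "?alt = (omega1 ^^ s) c"
      and nim: "?alt \<notin> (omega1 ^^ r) ` DU_box d a b"
      by (auto simp: s)
    have "(omega1 ^^ r) c = omega1 ?alt" unfolding c(2) by (simp add: s)
    then have "(omega1 ^^ r) c = 0" by (simp only: omega1_alt)
    then show "string_class TYPE('k) a b d r"
      unfolding string_class_def using c nim by (intro bexI[of _ c]) (auto simp: s)
  qed
qed

text \<open>\<open>omega1^(r-1)\<close> lands in degree \<open>d - r\<close>, which is negative, so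
  it gives 0, and 0 lies in every image.\<close>

lemma not_string_class:
  assumes "0 < r" "d < int r"
  shows "\<not> string_class TYPE('k::field) a b d r"
proof
  assume "string_class TYPE('k) a b d r"
  then obtain c :: "nat \<Rightarrow> nat \<Rightarrow> 'k" where c: "c \<in> DU_box (d - 1) a b"
    and nim: "(omega1 ^^ (r - 1)) c \<notin> (omega1 ^^ r) ` DU_box d a b"
    by (auto simp: string_class_def)
  have "(omega1 ^^ (r - 1)) c = 0"
    using assms omega1_pow_DU_box[OF c, of "r - 1"] by (intro DU_neg) (auto simp: DU_box_def)
  moreover have "(0 :: nat \<Rightarrow> nat \<Rightarrow> 'k) \<in> (omega1 ^^ r) ` DU_box d a b"
    by (rule image_eqI[of _ _ 0]) (simp_all only: omega_pow_zero zero_DU_box)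
  ultimately show False using nim by simp
qed

section \<open>Global sections\<close>

definition bimonom :: "'k::field \<Rightarrow> nat \<Rightarrow> nat \<Rightarrow> 'k poly poly" where
  "bimonom c s t = Polynomial.monom (Polynomial.monom c s) t"

lemma coeff_bimonom:
  "Polynomial.coeff (Polynomial.coeff (bimonom c s t) v) u = (if u = s \<and> v = t then c else 0)"
  by (simp add: bimonom_def)

lemma bimonom_0 [simp]: "bimonom 0 s t = 0"
  and bimonom_eq_0_iff [simp]: "bimonom c s t = 0 \<longleftrightarrow> c = 0"
  and bimonom_add: "bimonom (c + c') s t = bimonom c s t + bimonom c' s t"
  and bimonom_diff: "bimonom (c - c') s t = bimonom c s t - bimonom c' s t"
  and bimonom_mult: "bimonom c s t * bimonom c' s' t' = bimonom (c * c') (s + s') (t + t')"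
  by (simp_all add: bimonom_def add_monom diff_monom mult_monom)

lemma bimonom_1: "bimonom 1 0 0 = 1"
  by (simp add: bimonom_def monom_0 one_pCons)

lemma x1_bimonom: "x1 = bimonom 1 1 0" and x2_bimonom: "x2 = bimonom 1 0 1"
  by (simp_all add: x1_def x2_def bimonom_def monom_altdef)

lemma x1_power: "x1 ^ n = bimonom 1 n 0"
  by (induction n) (simp_all add: x1_bimonom bimonom_mult bimonom_1)

lemma x2_power: "x2 ^ n = bimonom 1 0 n"
  by (induction n) (simp_all add: x1_bimonom x2_bimonom bimonom_mult bimonom_1)

lemma x_powers: "[:[:c:]:] * x1 ^ s * x2 ^ t = bimonom c s t"
proof -
  have "[:[:c:]:] = bimonom c 0 0" by (simp add: bimonom_def monom_altdef)
  then show ?thesis by (simp add: x1_power x2_power bimonom_mult)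
qed

lemma bihomogeneous_imp_bimonom:
  assumes "bihomogeneous u v f"
  shows "\<exists>c. f = bimonom c (nat u) (nat v) \<and> (c \<noteq> 0 \<longrightarrow> 0 \<le> u \<and> 0 \<le> v)"
proof (cases "f = 0")
  case True
  then show ?thesis by (intro exI[of _ 0]) simp
next
  case False
  then obtain s t where st: "Polynomial.coeff (Polynomial.coeff f t) s \<noteq> 0"
    by (metis leading_coeff_0_iff)
  then have uv: "u = int s" "v = int t" using assms by (auto simp: bihomogeneous_def)
  have "Polynomial.coeff (Polynomial.coeff f t') s' = 0" if "(s', t') \<noteq> (s, t)" for s' t'
    using assms that unfolding uv bihomogeneous_def by fastforce
  then have "f = bimonom (Polynomial.coeff (Polynomial.coeff f t) s) s t"
    by (intro poly_eqI) (auto simp: coeff_bimonom)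
  then show ?thesis using uv by auto
qed

lemma bihomogeneous_bimonom: "bihomogeneous (int s) (int t) (bimonom c s t)"
  by (simp add: bihomogeneous_def coeff_bimonom)

lemma homogeneous_bimonom: "c \<noteq> 0 \<longrightarrow> int s + int t = n \<Longrightarrow> homogeneous n (bimonom c s t)"
  by (auto simp: homogeneous_def coeff_bimonom)

lemma homogeneous_1: "homogeneous 0 1"
  using homogeneous_bimonom[of 1 0 0 0] by (simp add: bimonom_1)

section \<open>Points of the projective line and global sections of line bundles\<close>

lemma primeideal_ring_of_type:
  fixes I :: "'a::comm_ring_1 set"
  assumes "0 \<in> I" "1 \<notin> I" and add: "\<And>f g. f \<in> I \<Longrightarrow> g \<in> I \<Longrightarrow> f + g \<in> I"
    and mult: "\<And>f g. f \<in> I \<Longrightarrow> g * f \<in> I"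
    and prime: "\<And>f g. f * g \<in> I \<Longrightarrow> f \<in> I \<or> g \<in> I"
  shows "primeideal I ring_of_type_algebra"
proof -
  let ?R = "ring_of_type_algebra :: 'a ring"
  interpret R: cring ?R by (rule cring_from_type_algebra)
  have neg: "\<ominus>\<^bsub>?R\<^esub> f = - f" for f
    by (rule R.minus_equality) (auto simp: ring_of_type_algebra_def)
  have "subgroup I (add_monoid ?R)"
  proof (rule R.add.subgroupI)
    fix f assume "f \<in> I"
    then have "- f \<in> I" using mult[of f "-1"] by simp
    then show "\<ominus>\<^bsub>?R\<^esub> f \<in> I" using neg by simp
  qed (use assms in \<open>auto simp: ring_of_type_algebra_def\<close>)
  then have "ideal I ?R"
    by (intro idealI R.ring_axioms) (use mult in \<open>auto simp: ring_of_type_algebra_def mult.commute\<close>)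
  then show ?thesis
    by (rule primeidealI) (use assms R.cring_axioms in \<open>auto simp: ring_of_type_algebra_def\<close>)
qed

lemma one_notin_Proj:
  assumes "P \<in> Proj" shows "1 \<notin> (P :: 'k::field poly poly set)"
proof
  assume "1 \<in> P"
  interpret primeideal P ring_of_type_algebra using assms by (simp add: Proj_def)
  have "P = carrier ring_of_type_algebra"
    using one_imp_carrier \<open>1 \<in> P\<close> by (simp add: ring_of_type_algebra_def)
  then show False using I_notcarr by simp
qed

lemma coeff_homogeneous_part:
  "Polynomial.coeff (Polynomial.coeff (homogeneous_part n f) t) s =
    (if s + t = n then Polynomial.coeff (Polynomial.coeff f t) s else 0)"
  by (auto simp: homogeneous_part_def coeff_sum if_distrib[of "\<lambda>p. Polynomial.coeff p s"] cong: if_cong)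

lemma var_dvd_iff: "[:0, 1:] dvd p \<longleftrightarrow> Polynomial.coeff p 0 = (0 :: 'a::idom)"
  using poly_eq_0_iff_dvd[of p 0] by (simp add: poly_0_coeff_0)

lemma dvd_x1: "x1 dvd f \<longleftrightarrow> (\<forall>t. Polynomial.coeff (Polynomial.coeff f t) 0 = 0)"
  by (simp add: x1_def const_poly_dvd_iff var_dvd_iff)

lemma dvd_x2: "x2 dvd f \<longleftrightarrow> Polynomial.coeff f 0 = 0"
  by (simp add: x2_def var_dvd_iff)

lemma prime_elem_var: "prime_elem [:0, 1 :: 'a::idom:]"
  by (rule prime_elemI) (auto simp: var_dvd_iff coeff_mult_0)

lemma prime_x1: "prime_elem (x1 :: 'k::field poly poly)"
  unfolding x1_def by (intro lift_prime_elem_poly prime_elem_var)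

lemma prime_x2: "prime_elem (x2 :: 'k::field poly poly)"
  unfolding x2_def by (rule prime_elem_var)

lemma prime_in_Proj:
  fixes p :: "'k::field poly poly"
  assumes "prime_elem p" "\<And>f n. p dvd f \<Longrightarrow> p dvd homogeneous_part n f" "\<not> p dvd x1 \<or> \<not> p dvd x2"
  shows "{f. p dvd f} \<in> Proj"
  using assms primeideal_ring_of_type[of "{f. p dvd f}"]
  by (auto simp: Proj_def prime_elem_def)

text \<open>The ideals of \<open>x1\<close> and \<open>x2\<close> are the two torus-fixed points;
  regularity there is what excludes negative exponents in a weight vector.\<close>

lemma x1_in_Proj: "{f. x1 dvd f} \<in> (Proj :: 'k::field poly poly set set)"
  by (rule prime_in_Proj[OF prime_x1]) (auto simp: dvd_x1 coeff_homogeneous_part x2_bimonom coeff_bimonom)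

lemma x2_in_Proj: "{f. x2 dvd f} \<in> (Proj :: 'k::field poly poly set set)"
  by (rule prime_in_Proj[OF prime_x2])
    (auto simp: dvd_x2 poly_eq_iff coeff_homogeneous_part x1_bimonom bimonom_def)

lemma zero_in_Proj: "{0} \<in> (Proj :: 'k::field poly poly set set)"
proof -
  have "primeideal {0 :: 'k poly poly} ring_of_type_algebra"
    by (rule primeideal_ring_of_type) auto
  moreover have "homogeneous_part n 0 = (0 :: 'k poly poly)" for n
    by (intro poly_eqI) (simp add: coeff_homogeneous_part)
  ultimately show ?thesis by (auto simp: Proj_def x1_def)
qed

text \<open>The generic point lies in every nonempty open set, so each local fraction of a section
  equals its value at \<open>{0}\<close>.\<close>

lemma zero_in_Proj_open:
  assumes "Proj_open V" "P \<in> V" shows "{0} \<in> (V :: 'k::field poly poly set set)"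
proof -
  obtain A where A: "V = {P \<in> Proj. \<not> A \<subseteq> P}" using assms by (auto simp: Proj_open_def)
  interpret primeideal P ring_of_type_algebra using assms A by (simp add: Proj_def)
  have "0 \<in> P" using additive_subgroup.zero_closed[OF additive_subgroup_axioms]
    by (simp add: ring_of_type_algebra_def)
  then have "\<not> A \<subseteq> {0}" using assms A by auto
  then show ?thesis using A zero_in_Proj by simp
qed

lemma Proj_open_Proj: "Proj_open (Proj :: 'k::field poly poly set set)"
proof -
  have "{1} \<subseteq> {f :: 'k poly poly. \<exists>n. homogeneous n f}"
    using homogeneous_1 by auto
  moreover have "Proj = {P \<in> Proj. \<not> {1} \<subseteq> (P :: 'k poly poly set)}" using one_notin_Proj by auto
  ultimately show ?thesis unfolding Proj_open_def by blast
qed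

lemma Fract_power: "Fract p 1 ^ n = Fract (p ^ n) 1"
  by (induction n) (simp_all add: One_fract_def)

lemma Fract_powi:
  assumes "p \<noteq> 0"
  shows "Fract p 1 powi u * Fract (p ^ nat (- u)) 1 = Fract (p ^ nat u) 1"
proof -
  have "Fract p 1 \<noteq> 0" using assms by (simp add: Zero_fract_def eq_fract)
  then show ?thesis
    by (cases "0 \<le> u") (simp_all add: power_int_def Fract_power[symmetric] One_fract_def[symmetric] field_simps)
qed

text \<open>All values of the section agree with the generic one, which is
  \<open>c x1^u x2^v\<close>. For \<open>u < 0\<close> and \<open>c\<close> nonzero this has a pole
  at the point of \<open>x1\<close>, where the section is a fraction with denominator prime to
  \<open>x1\<close>; similarly for \<open>v\<close> and \<open>x2\<close>. So only honest monomials
  remain.\<close>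

lemma global_section_bihomogeneous:
  fixes s :: "'k::field poly poly set \<Rightarrow> 'k poly poly fract"
  assumes s: "s \<in> O_sections n Proj" and bihom: "bihomogeneous_fract u v (s {0})"
  shows "\<exists>c. (\<forall>P\<in>Proj. s P = Fract (bimonom c (nat u) (nat v)) 1) \<and> (c \<noteq> 0 \<longrightarrow> 0 \<le> u \<and> 0 \<le> v)"
proof -
  define z where "z = s {0}"
  have loc: "s P = z \<and> (\<exists>f g. g \<notin> P \<and> g \<noteq> 0 \<and> z = Fract f g)" if P: "P \<in> Proj" for P
  proof -
    obtain V f g where V: "Proj_open V" "P \<in> V" "\<forall>Q\<in>V. g \<notin> Q \<and> s Q = Fract f g"
      using s P unfolding O_sections_def by blast
    then have "{0} \<in> V" using zero_in_Proj_open by blast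
    then have "g \<notin> {0}" "s {0} = Fract f g" using V by blast+
    then show ?thesis using V by (auto simp: z_def)
  qed
  obtain c where c: "z = Fract [:[:c:]:] 1 * Fract x1 1 powi u * Fract x2 1 powi v"
    using bihom by (auto simp: bihomogeneous_fract_def z_def)
  \<comment> \<open>Multiplication by \<open>x1 ^ nat (- u)\<close> and
    \<open>x2 ^ nat (- v)\<close> clears the negative exponents, if any, so all signs of
    \<open>u\<close> and \<open>v\<close> share one equation in the polynomial ring.\<close>
  let ?u = "nat u" and ?u' = "nat (- u)" and ?v = "nat v" and ?v' = "nat (- v)"
  have "x1 \<noteq> (0 :: 'k poly poly)" "x2 \<noteq> (0 :: 'k poly poly)" by (simp_all add: x1_def x2_def)
  then have pw: "Fract x1 1 powi u * Fract (x1 ^ ?u') 1 = (Fract (x1 ^ ?u) 1 :: 'k poly poly fract)"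
      "Fract x2 1 powi v * Fract (x2 ^ ?v') 1 = (Fract (x2 ^ ?v) 1 :: 'k poly poly fract)"
    using Fract_powi by blast+
  have "z * Fract (x1 ^ ?u') 1 * Fract (x2 ^ ?v') 1 =
      Fract [:[:c:]:] 1 * (Fract x1 1 powi u * Fract (x1 ^ ?u') 1) * (Fract x2 1 powi v * Fract (x2 ^ ?v') 1)"
    unfolding c by (simp only: mult_ac)
  then have z: "z * Fract (x1 ^ ?u' * x2 ^ ?v') 1 = Fract (bimonom c ?u ?v) 1"
    unfolding pw by (simp flip: x_powers add: mult.assoc)
  have eq: "f * (x1 ^ ?u' * x2 ^ ?v') = bimonom c ?u ?v * g" if "z = Fract f g" "g \<noteq> 0" for f g
    using z that by (simp add: eq_fract)
  have "c = 0" if "u < 0"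
  proof (rule ccontr)
    assume nz: "c \<noteq> 0"
    obtain f g where "\<not> x1 dvd g" "z = Fract f g" "g \<noteq> 0" using loc[OF x1_in_Proj] by auto
    then have "f * (x1 ^ ?u' * x2 ^ ?v') = bimonom c ?u ?v * g" using eq by blast
    moreover have "x1 dvd f * (x1 ^ ?u' * x2 ^ ?v')"
      using that by (intro dvd_mult dvd_mult2 dvd_power) simp
    ultimately have "x1 dvd bimonom c ?u ?v"
      using prime_elem_dvd_mult_iff[OF prime_x1] \<open>\<not> x1 dvd g\<close> by metis
    then have "Polynomial.coeff (Polynomial.coeff (bimonom c ?u ?v) ?v) 0 = 0" unfolding dvd_x1 ..
    then show False using nz that by (simp add: coeff_bimonom)
  qed
  moreover have "c = 0" if "v < 0"
  proof (rule ccontr)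
    assume nz: "c \<noteq> 0"
    obtain f g where "\<not> x2 dvd g" "z = Fract f g" "g \<noteq> 0" using loc[OF x2_in_Proj] by auto
    then have "f * (x1 ^ ?u' * x2 ^ ?v') = bimonom c ?u ?v * g" using eq by blast
    moreover have "x2 dvd f * (x1 ^ ?u' * x2 ^ ?v')"
      using that by (intro dvd_mult dvd_power) simp
    ultimately have "x2 dvd bimonom c ?u ?v"
      using prime_elem_dvd_mult_iff[OF prime_x2] \<open>\<not> x2 dvd g\<close> by metis
    then show False using nz that by (auto simp: dvd_x2 bimonom_def)
  qed
  ultimately have nonneg: "c \<noteq> 0 \<longrightarrow> 0 \<le> u \<and> 0 \<le> v" by (meson not_le)
  have "z = Fract (bimonom c ?u ?v) 1"
  proof (cases "c = 0")
    case True
    then show ?thesis unfolding c by (simp add: Zero_fract_def[symmetric])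
  next
    case False
    then have "?u' = 0" "?v' = 0" using nonneg by auto
    then show ?thesis using z by (simp add: One_fract_def[symmetric])
  qed
  then show ?thesis using loc nonneg by metis
qed

lemma bimonom_global_section:
  assumes "c \<noteq> 0 \<longrightarrow> int s + int t = n"
  shows "(\<lambda>P. if P \<in> Proj then Fract (bimonom c s t) 1 else 0) \<in> O_sections n (Proj :: 'k::field poly poly set set)"
proof -
  have hom: "homogeneous (0 + n) (bimonom c s t)" "homogeneous 0 (1 :: 'k poly poly)"
    using homogeneous_bimonom[OF assms] homogeneous_1 by auto
  show ?thesis
    unfolding O_sections_def
  proof (intro CollectI conjI ballI allI impI)
    fix P :: "'k poly poly set" assume "P \<in> Proj"
    then show "\<exists>V f g m. Proj_open V \<and> P \<in> V \<and> V \<subseteq> Proj \<and> homogeneous (m + n) f \<and> homogeneous m g \<and>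
        (\<forall>Q\<in>V. g \<notin> Q \<and> (if Q \<in> Proj then Fract (bimonom c s t) 1 else 0) = Fract f g)"
      using Proj_open_Proj one_notin_Proj hom
      by (intro exI[of _ Proj] exI[of _ "bimonom c s t"] exI[of _ 1] exI[of _ 0]) auto
  qed simp
qed

section \<open>Sections of weight \<open>(a-1,b-1)\<close> as scalar arrays in a box\<close>

definition to_poly :: "nat \<Rightarrow> nat \<Rightarrow> (nat \<Rightarrow> nat \<Rightarrow> 'k::field) \<Rightarrow> nat \<Rightarrow> nat \<Rightarrow> 'k poly poly" where
  "to_poly a b c = (\<lambda>i j. bimonom (c i j) (a - 1 - i) (b - 1 - j))"

text \<open>Multiplying by a variable raises the exponent \<open>a - 1 - Suc i\<close> to
  \<open>a - 1 - i\<close>. Truncated subtraction breaks this only outside the box, where the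
  coefficient is 0.\<close>

lemma omega_to_poly:
  assumes "c \<in> box a b" shows "omega x1 x2 (to_poly a b c) = to_poly a b (omega1 c)"
proof (intro ext)
  fix i j
  have "bimonom (c (Suc i) j) (Suc (a - 1 - Suc i)) (b - 1 - j) = bimonom (c (Suc i) j) (a - 1 - i) (b - 1 - j)"
  proof (cases "c (Suc i) j = 0")
    case False
    then have "Suc i < a" using assms by (auto simp: box_def)
    then have "Suc (a - 1 - Suc i) = a - 1 - i" by linarith
    then show ?thesis by simp
  qed simp
  moreover have "bimonom (c i (Suc j)) (a - 1 - i) (Suc (b - 1 - Suc j)) = bimonom (c i (Suc j)) (a - 1 - i) (b - 1 - j)"
  proof (cases "c i (Suc j) = 0")
    case False
    then have "Suc j < b" using assms by (auto simp: box_def)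
    then have "Suc (b - 1 - Suc j) = b - 1 - j" by linarith
    then show ?thesis by simp
  qed simp
  ultimately show "omega x1 x2 (to_poly a b c) i j = to_poly a b (omega1 c) i j"
    by (simp add: omega_def to_poly_def x1_bimonom x2_bimonom bimonom_mult bimonom_add)
qed

lemma omega_pow_to_poly:
  "c \<in> box a b \<Longrightarrow> (omega x1 x2 ^^ n) (to_poly a b c) = to_poly a b ((omega1 ^^ n) c)"
  by (induction n) (simp_all add: omega_to_poly omega1_pow_box)

lemma to_poly_eq_iff: "to_poly a b c = to_poly a b c' \<longleftrightarrow> c = c'"
proof
  assume eq: "to_poly a b c = to_poly a b c'"
  have "c i j = c' i j" for i j
    using fun_cong[OF fun_cong[OF eq], of i j] by (simp add: to_poly_def bimonom_def)
  then show "c = c'" by blast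
qed simp

lemma omega_fract_pow:
  "(omega_fract ^^ n) (\<lambda>i j. Fract (f i j) 1) = (\<lambda>i j. Fract ((omega x1 x2 ^^ n) f i j) 1)"
  by (induction n) (simp_all add: omega_def)

definition glob :: "nat \<Rightarrow> nat \<Rightarrow> (nat \<Rightarrow> nat \<Rightarrow> 'k::field) \<Rightarrow> 'k poly poly set \<Rightarrow> nat \<Rightarrow> nat \<Rightarrow> 'k poly poly fract" where
  "glob a b c = (\<lambda>P i j. if P \<in> Proj then Fract (to_poly a b c i j) 1 else 0)"

lemma omega_pow_glob:
  assumes "c \<in> box a b"
  shows "(omega_fract ^^ n) (glob a b c P) = glob a b ((omega1 ^^ n) c) P"
proof (cases "P \<in> Proj")
  case True
  then show ?thesis by (simp add: glob_def omega_fract_pow omega_pow_to_poly[OF assms])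
next
  case False
  then have "glob a b c' P = 0" for c' :: "nat \<Rightarrow> nat \<Rightarrow> 'a"
    by (simp add: glob_def fun_eq_iff zero_fun_apply)
  then show ?thesis by (simp add: omega_pow_zero)
qed

lemma glob_eq_iff: "glob a b c = glob a b c' \<longleftrightarrow> c = c'"
proof
  assume eq: "glob a b c = glob a b c'"
  have "to_poly a b c i j = to_poly a b c' i j" for i j
    using fun_cong[OF fun_cong[OF fun_cong[OF eq, of "{0}"], of i], of j]
    by (simp add: glob_def zero_in_Proj eq_fract)
  then show "c = c'" using to_poly_eq_iff[of a b c c'] by blast
qed simp

text \<open>In weight \<open>(a-1,b-1)\<close> the coefficient at index \<open>(i, j)\<close> has
  weight \<open>(a-1-i, b-1-j)\<close>, hence is a scalar times that monomial and vanishes unless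
  both exponents are nonnegative. The hypothesis \<open>deg\<close> says that the twist is the
  degree left over by the divided power.\<close>

lemma H0_F_eq:
  fixes a b :: nat
  assumes deg: "int a + int b - 2 = d + n" and u: "u = int a - 1" and v: "v = int b - 1"
  shows "(H0_F d r n u v :: ('k::field poly poly set \<Rightarrow> nat \<Rightarrow> nat \<Rightarrow> 'k poly poly fract) set) =
    glob a b ` {c \<in> DU_box d a b. (omega1 ^^ r) c = 0}"
proof (intro equalityI subsetI)
  fix \<sigma> :: "'k poly poly set \<Rightarrow> nat \<Rightarrow> nat \<Rightarrow> 'k poly poly fract"
  assume "\<sigma> \<in> H0_F d r n u v"
  then have DU: "\<sigma> P \<in> DU d" and sec: "(\<lambda>P. \<sigma> P i j) \<in> O_sections n Proj"
    and ker: "(omega_fract ^^ r) (\<sigma> P) = 0"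
    and bihom: "bihomogeneous_fract (u - int i) (v - int j) (\<sigma> P i j)" for P i j
    by (auto simp: H0_F_def F_sections_def DO_sections_def zero_fun_def)
  have "\<forall>i j. \<exists>c. (\<forall>P\<in>Proj. \<sigma> P i j = Fract (bimonom c (nat (u - int i)) (nat (v - int j))) 1) \<and>
      (c \<noteq> 0 \<longrightarrow> 0 \<le> u - int i \<and> 0 \<le> v - int j)"
    using global_section_bihomogeneous[OF sec bihom] by blast
  then obtain c where c: "\<And>i j P. P \<in> Proj \<Longrightarrow>
        \<sigma> P i j = Fract (bimonom (c i j) (nat (u - int i)) (nat (v - int j))) 1"
      "\<And>i j. c i j \<noteq> 0 \<Longrightarrow> 0 \<le> u - int i \<and> 0 \<le> v - int j"
    by metis
  have box: "c \<in> box a b" using c(2) unfolding u v box_def by fastforce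
  have "c \<in> DU d"
    unfolding DU_def
  proof (intro CollectI allI impI)
    fix i j assume "c i j \<noteq> 0"
    then have "\<sigma> {0} i j \<noteq> 0" using c(1)[OF zero_in_Proj] by (simp add: Zero_fract_def eq_fract)
    then show "int (i + j) = d" using DU[of "{0}"] by (auto simp: DU_def)
  qed
  moreover have \<sigma>: "\<sigma> = glob a b c"
  proof (intro ext)
    fix P i j
    have "nat (u - int i) = a - 1 - i" "nat (v - int j) = b - 1 - j" using u v by auto
    moreover have "\<sigma> P i j = 0" if "P \<notin> Proj" using sec that by (auto simp: O_sections_def)
    ultimately show "\<sigma> P i j = glob a b c P i j"
      using c(1) by (simp add: glob_def to_poly_def)
  qed
  moreover have "(omega1 ^^ r) c = 0"
  proof -
    have "glob a b ((omega1 ^^ r) c) = glob a b 0"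
      using ker unfolding \<sigma> omega_pow_glob[OF box]
      by (intro ext) (simp add: zero_fun_apply glob_def to_poly_def Zero_fract_def)
    then show ?thesis by (simp add: glob_eq_iff)
  qed
  ultimately show "\<sigma> \<in> glob a b ` {c \<in> DU_box d a b. (omega1 ^^ r) c = 0}"
    using box by (auto simp: DU_box_def)
next
  fix \<sigma> :: "'k poly poly set \<Rightarrow> nat \<Rightarrow> nat \<Rightarrow> 'k poly poly fract"
  assume "\<sigma> \<in> glob a b ` {c \<in> DU_box d a b. (omega1 ^^ r) c = 0}"
  then obtain c where c: "c \<in> DU d" "c \<in> box a b" "(omega1 ^^ r) c = 0" and \<sigma>: "\<sigma> = glob a b c"
    by (auto simp: DU_box_def)
  have supp: "i + j = nat d \<and> 0 \<le> d \<and> i < a \<and> j < b" if "c i j \<noteq> 0" for i j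
    using c that by (force simp: DU_def box_def)
  have "\<sigma> P \<in> DU d" for P
    unfolding DU_def
  proof (intro CollectI allI impI)
    fix i j assume "\<sigma> P i j \<noteq> 0"
    then have "c i j \<noteq> 0"
      by (auto simp: \<sigma> glob_def to_poly_def Zero_fract_def[symmetric] split: if_splits)
    then show "int (i + j) = d" using supp[of i j] by simp
  qed
  moreover have "(\<lambda>P. \<sigma> P i j) \<in> O_sections n Proj" for i j
    unfolding \<sigma> glob_def to_poly_def
  proof (rule bimonom_global_section, rule impI)
    assume "c i j \<noteq> 0"
    then have "i < a" "j < b" "int (i + j) = d" using supp[of i j] by auto
    then show "int (a - 1 - i) + int (b - 1 - j) = n" using deg by simp
  qed
  moreover have "(omega_fract ^^ r) (\<sigma> P) = 0" for P
    unfolding \<sigma> omega_pow_glob[OF c(2)] c(3)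
    by (simp add: fun_eq_iff glob_def to_poly_def zero_fun_apply Zero_fract_def)
  moreover have "bihomogeneous_fract (u - int i) (v - int j) (\<sigma> P i j)" for P i j
  proof (cases "P \<in> Proj \<and> c i j \<noteq> 0")
    case True
    then have "i < a" "j < b" using supp[of i j] by auto
    then have e: "u - int i = int (a - 1 - i)" "v - int j = int (b - 1 - j)" using u v by auto
    have "\<sigma> P i j = Fract ([:[:c i j:]:] * x1 ^ (a - 1 - i) * x2 ^ (b - 1 - j)) 1"
      using True by (simp only: \<sigma> glob_def to_poly_def x_powers if_True)
    then have "\<sigma> P i j = Fract [:[:c i j:]:] 1 * Fract x1 1 powi (u - int i) * Fract x2 1 powi (v - int j)"
      unfolding e power_int_of_nat Fract_power by simp
    then show ?thesis unfolding bihomogeneous_fract_def by blast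
  next
    case False
    then have "\<sigma> P i j = 0" by (auto simp: \<sigma> glob_def to_poly_def Zero_fract_def)
    then show ?thesis
      unfolding bihomogeneous_fract_def by (intro exI[of _ 0]) (simp add: Zero_fract_def[symmetric])
  qed
  ultimately show "\<sigma> \<in> H0_F d r n u v"
    by (simp add: H0_F_def F_sections_def DO_sections_def zero_fun_def)
qed

lemma beta_glob:
  assumes "f \<in> box a b"
  shows "beta (glob a b f, glob a b g) = glob a b (omega1 f - g)"
proof (intro ext)
  fix P i j
  show "beta (glob a b f, glob a b g) P i j = glob a b (omega1 f - g) P i j"
    using fun_cong[OF fun_cong[OF omega_pow_glob[OF assms, of 1 P]], of i j]
    by (simp add: beta_def minus_fun_apply) (simp add: glob_def to_poly_def bimonom_diff minus_fun_apply)
qed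

text \<open>Since \<open>d + e = (d - 1) + (e + 1)\<close>, all three spaces of sections are kernels
  in the same box, and \<open>glob\<close> carries \<open>beta\<close> to
  \<open>omega1 f - g\<close>.\<close>

lemma beta_surjective_iff:
  fixes a b r :: nat and d e :: int
  assumes deg: "int a + int b - 2 = d + e" and r: "0 < r"
  shows "(H0_F (d - 1) r (e + 1) (int a - 1) (int b - 1)
            :: ('k::field poly poly set \<Rightarrow> nat \<Rightarrow> nat \<Rightarrow> 'k poly poly fract) set)
          \<subseteq> beta ` (H0_F d (r + 1) e (int a - 1) (int b - 1) \<times>
                     H0_F (d - 1) (r - 1) (e + 1) (int a - 1) (int b - 1)) \<longleftrightarrow>
    \<not> string_class TYPE('k) a b d r"
proof -
  have deg': "int a + int b - 2 = d - 1 + (e + 1)" using deg by simp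
  have box: "f \<in> box a b" if "f \<in> DU_box d a b" for f :: "nat \<Rightarrow> nat \<Rightarrow> 'k"
    using that by (simp add: DU_box_def)
  have "glob a b h \<in> beta ` (glob a b ` {c \<in> DU_box d a b. (omega1 ^^ (r + 1)) c = 0} \<times>
          glob a b ` {c \<in> DU_box (d - 1) a b. (omega1 ^^ (r - 1)) c = 0}) \<longleftrightarrow>
      (\<exists>f\<in>DU_box d a b. (omega1 ^^ (r + 1)) f = 0 \<and>
          (\<exists>g\<in>DU_box (d - 1) a b. (omega1 ^^ (r - 1)) g = 0 \<and> h = omega1 f - g))"
    (is "_ \<in> beta ` (glob a b ` ?F \<times> glob a b ` ?G) \<longleftrightarrow> _") for h :: "nat \<Rightarrow> nat \<Rightarrow> 'k"
  proof -
    have "glob a b h \<in> beta ` (glob a b ` ?F \<times> glob a b ` ?G) \<longleftrightarrow>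
        (\<exists>f\<in>?F. \<exists>g\<in>?G. glob a b h = beta (glob a b f, glob a b g))" by blast
    also have "\<dots> \<longleftrightarrow> (\<exists>f\<in>?F. \<exists>g\<in>?G. h = omega1 f - g)"
      using box by (intro bex_cong refl) (simp add: beta_glob glob_eq_iff)
    finally show ?thesis by blast
  qed
  then show ?thesis
    unfolding string_class_iff_cokernel[OF r] H0_F_eq[OF deg refl refl] H0_F_eq[OF deg' refl refl]
      image_subset_iff by (simp only: mem_Collect_eq Ball_def imp_conjL not_not)
qed

section \<open>The ideals \<open>J(d,r)\<close>\<close>

definition fdiff :: "(nat \<Rightarrow> 'a::comm_ring_1) \<Rightarrow> nat \<Rightarrow> 'a" where
  "fdiff h = (\<lambda>i. h (Suc i) - h i)"

text \<open>The value at \<open>i\<close> of a polynomial function given by its coefficients in the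
  binomial basis. Unlike powers of \<open>i\<close>, this basis represents every sequence on a
  finite interval in any characteristic.\<close>

definition newton :: "(nat \<Rightarrow> 'a::comm_ring_1) \<Rightarrow> nat \<Rightarrow> nat \<Rightarrow> 'a" where
  "newton e r i = (\<Sum>k\<le>r. of_nat (i choose k) * e k)"

text \<open>Newton's forward difference formula. Pascal's rule splits the expansion at
  \<open>Suc i\<close> into the expansions of \<open>h\<close> and of \<open>fdiff h\<close> at
  \<open>i\<close>, and \<open>h i + fdiff h i = h (Suc i)\<close>; hence the induction over all
  \<open>h\<close>.\<close>

lemma newton_expansion: "i \<le> N \<Longrightarrow> newton (\<lambda>k. (fdiff ^^ k) h 0) N i = h i"
proof (induction i arbitrary: h N)
  case 0
  have "newton (\<lambda>k. (fdiff ^^ k) h 0) N 0 = (\<Sum>k\<le>N. if k = 0 then h 0 else 0)"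
    unfolding newton_def by (intro sum.cong) (auto simp: binomial_eq_0)
  then show ?case by simp
next
  case (Suc i)
  then obtain N' where N: "N = Suc N'" "i \<le> N'" by (cases N) auto
  define D where "D k = (fdiff ^^ k) h 0" for k
  have "newton D N (Suc i) = D 0 + (\<Sum>k\<le>N'. of_nat (Suc i choose Suc k) * D (Suc k))"
    unfolding newton_def N by (subst sum.atMost_Suc_shift) simp
  also have "\<dots> = (\<Sum>k\<le>N'. of_nat (i choose k) * D (Suc k)) +
      (D 0 + (\<Sum>k\<le>N'. of_nat (i choose Suc k) * D (Suc k)))"
    by (simp add: algebra_simps sum.distrib)
  also have "D 0 + (\<Sum>k\<le>N'. of_nat (i choose Suc k) * D (Suc k)) = newton D N i"
    unfolding newton_def N by (subst sum.atMost_Suc_shift) simp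
  also have "newton D N i = h i" using Suc.IH[of N h] N unfolding D_def by simp
  also have "(\<Sum>k\<le>N'. of_nat (i choose k) * D (Suc k)) = newton (\<lambda>k. (fdiff ^^ k) (fdiff h) 0) N' i"
    unfolding newton_def D_def by (simp add: funpow_swap1)
  also have "\<dots> = fdiff h i" by (rule Suc.IH[OF N(2)])
  also have "fdiff h i + h i = h (Suc i)" by (simp add: fdiff_def)
  finally show ?case unfolding D_def .
qed

lemma fdiff_newton: "fdiff (newton e (Suc r)) = newton (\<lambda>k. e (Suc k)) r"
proof
  fix i
  have expand: "newton e (Suc r) l = e 0 + (\<Sum>k\<le>r. of_nat (l choose Suc k) * e (Suc k))" for l
    unfolding newton_def by (subst sum.atMost_Suc_shift) simp
  then show "fdiff (newton e (Suc r)) i = newton (\<lambda>k. e (Suc k)) r i"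
    unfolding fdiff_def expand by (simp add: newton_def algebra_simps sum.distrib)
qed

lemma fdiff_pow_newton: "(fdiff ^^ r) (newton e r) i = e r"
proof (induction r arbitrary: e)
  case 0
  show ?case by (simp add: newton_def)
next
  case (Suc r)
  have "(fdiff ^^ Suc r) (newton e (Suc r)) = (fdiff ^^ r) (fdiff (newton e (Suc r)))"
    by (simp add: funpow_swap1)
  then show ?case using Suc[of "\<lambda>k. e (Suc k)"] by (simp only: fdiff_newton)
qed

lemma fdiff_pow_const:
  assumes "\<And>i. i \<le> m \<Longrightarrow> g i = K" "0 < l" "i + l \<le> m"
  shows "(fdiff ^^ l) g i = 0"
  using assms(2,3)
proof (induction l arbitrary: i)
  case (Suc l)
  show ?case
  proof (cases "l = 0")
    case True
    then show ?thesis using Suc assms(1) by (simp add: fdiff_def)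
  next
    case False
    then show ?thesis using Suc by (simp add: fdiff_def)
  qed
qed simp

text \<open>On \<open>D\<^sup>dU\<close>, after the sign change \<open>(-1)\<^sup>i\<close>, the operator \<open>omega1\<close> is minus the forward difference.\<close>

lemma omega1_pow_fdiff:
  fixes c :: "nat \<Rightarrow> nat \<Rightarrow> 'k::comm_ring_1"
  assumes "\<And>i. i \<le> m + r \<Longrightarrow> (-1) ^ i * c i (m + r - i) = h i" "i \<le> m"
  shows "(-1) ^ i * (omega1 ^^ r) c i (m - i) = (-1) ^ r * (fdiff ^^ r) h i"
  using assms
proof (induction r arbitrary: m i)
  case (Suc r)
  have IH: "(-1) ^ i * (omega1 ^^ r) c i (Suc m - i) = (-1) ^ r * (fdiff ^^ r) h i" if "i \<le> Suc m" for i
    using Suc.IH[of "Suc m" i] Suc.prems(1) that by simp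
  have "(-1) ^ i * (omega1 ^^ Suc r) c i (m - i) =
      - ((-1) ^ Suc i * (omega1 ^^ r) c (Suc i) (Suc m - Suc i)) + (-1) ^ i * (omega1 ^^ r) c i (Suc m - i)"
    using Suc.prems(2) by (simp add: omega_def algebra_simps Suc_diff_le)
  also have "\<dots> = (-1) ^ Suc r * (fdiff ^^ Suc r) h i"
    unfolding IH[OF le_SucI[OF Suc.prems(2)]] IH[OF Suc_le_mono[THEN iffD2, OF Suc.prems(2)]]
    by (simp add: fdiff_def algebra_simps)
  finally show ?case .
qed simp

lemma minus_one_power_self: "(-1) ^ n * ((-1) ^ n * x) = (x :: 'a::comm_ring_1)"
  by (simp add: mult.assoc[symmetric] power_add[symmetric])

text \<open>Stands for membership of \<open>x1^u x2^v\<close> in \<open>J(m+r,r)\<close>. The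
  generator has bidegree \<open>(m,m)\<close>, so its multiple by this monomial has bidegree
  \<open>(m+u,m+v)\<close>; this explains the sides of the box, while the scalar array stays
  \<open>alt m\<close>.\<close>

definition J_monomial :: "'k::field itself \<Rightarrow> nat \<Rightarrow> nat \<Rightarrow> nat \<Rightarrow> nat \<Rightarrow> bool" where
  "J_monomial t m r u v \<longleftrightarrow>
     (alt m :: nat \<Rightarrow> nat \<Rightarrow> 'k) \<in> (omega1 ^^ r) ` DU_box (int (m + r)) (m + 1 + u) (m + 1 + v)"

text \<open>The sign change turns a preimage of \<open>alt m\<close> into a sequence on
  \<open>0..m+r\<close> with constant r-th difference \<open>(-1)^r\<close>; the factor
  \<open>(-1)^r\<close> normalises the leading coefficient to 1. The bound on the second index
  removes the positions below \<open>r - v\<close>, the bound on the first those above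
  \<open>m + u\<close>. The parameter \<open>m\<close> survives only in the argument
  \<open>m + i\<close>, which prepares periodicity.\<close>

lemma J_monomial_iff_newton:
  "J_monomial TYPE('k::field) m r u v \<longleftrightarrow>
    (\<exists>e :: nat \<Rightarrow> 'k. e r = 1 \<and> (\<forall>i. i + v < r \<longrightarrow> newton e r i = 0) \<and>
       (\<forall>i\<le>r. u < i \<longrightarrow> newton e r (m + i) = 0))"
proof
  assume "J_monomial TYPE('k) m r u v"
  then obtain c :: "nat \<Rightarrow> nat \<Rightarrow> 'k" where c: "c \<in> DU_box (int (m + r)) (m + 1 + u) (m + 1 + v)"
    and alt: "(omega1 ^^ r) c = alt m"
    unfolding J_monomial_def by (metis imageE)
  define h where "h = (\<lambda>i. (-1) ^ i * c i (m + r - i))"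
  define D where "D = (\<lambda>k. (fdiff ^^ k) h 0)"
  have const: "(fdiff ^^ r) h i = (-1) ^ r" if "i \<le> m" for i
  proof -
    have "(-1) ^ r * (fdiff ^^ r) h i = (-1) ^ i * alt m i (m - i)"
      using omega1_pow_fdiff[of m r c h i] that by (simp add: h_def alt)
    also have "\<dots> = 1" using that by (simp add: alt_def power_add[symmetric])
    finally have "(-1) ^ r * ((-1) ^ r * (fdiff ^^ r) h i) = (-1) ^ r * 1" by simp
    then show ?thesis unfolding minus_one_power_self by simp
  qed
  \<comment> \<open>A constant r-th difference on \<open>0..m\<close> has vanishing further
    differences at 0 up to order \<open>m\<close>, so the Newton expansion of \<open>h\<close> on
    \<open>0..m+r\<close> stops at \<open>r\<close>.\<close>
  have D0: "D k = 0" if "r < k" "k \<le> m + r" for k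
  proof -
    have "(fdiff ^^ k) h = (fdiff ^^ (k - r)) ((fdiff ^^ r) h)"
      using that by (metis comp_apply funpow_add le_add_diff_inverse2 less_imp_le)
    then show ?thesis
      using fdiff_pow_const[of m "(fdiff ^^ r) h" "(-1) ^ r" "k - r" 0] const that by (simp add: D_def)
  qed
  have h: "newton D r i = h i" if "i \<le> m + r" for i
  proof -
    have "newton D (m + r) i = newton D r i"
      unfolding newton_def using D0 by (intro sum.mono_neutral_right) auto
    then show ?thesis using newton_expansion[OF that, of h] unfolding D_def by simp
  qed
  define e where "e = (\<lambda>k. (-1) ^ r * D k)"
  have newton_e: "newton e r i = (-1) ^ r * newton D r i" for i
    by (simp add: newton_def e_def sum_distrib_left mult_ac)
  have "e r = 1" using const[of 0] by (simp add: e_def D_def power_add[symmetric])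
  moreover have "newton e r i = 0" if "i + v < r" for i
  proof -
    have "c i (m + r - i) = 0"
    proof (rule ccontr)
      assume "c i (m + r - i) \<noteq> 0"
      then have "m + r - i < m + 1 + v" using c unfolding DU_box_def box_def by blast
      then show False using that by linarith
    qed
    then show ?thesis using that by (simp add: newton_e h h_def)
  qed
  moreover have "newton e r (m + i) = 0" if "i \<le> r" "u < i" for i
  proof -
    have "c (m + i) (r - i) = 0"
    proof (rule ccontr)
      assume "c (m + i) (r - i) \<noteq> 0"
      then have "m + i < m + 1 + u" using c unfolding DU_box_def box_def by blast
      then show False using that by linarith
    qed
    then show ?thesis using that by (simp add: newton_e h h_def)
  qed
  ultimately show "\<exists>e :: nat \<Rightarrow> 'k. e r = 1 \<and> (\<forall>i. i + v < r \<longrightarrow> newton e r i = 0) \<and>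
       (\<forall>i\<le>r. u < i \<longrightarrow> newton e r (m + i) = 0)" by blast
next
  assume "\<exists>e :: nat \<Rightarrow> 'k. e r = 1 \<and> (\<forall>i. i + v < r \<longrightarrow> newton e r i = 0) \<and>
       (\<forall>i\<le>r. u < i \<longrightarrow> newton e r (m + i) = 0)"
  then obtain e :: "nat \<Rightarrow> 'k" where e: "e r = 1" "\<And>i. i + v < r \<Longrightarrow> newton e r i = 0"
      "\<And>i. i \<le> r \<Longrightarrow> u < i \<Longrightarrow> newton e r (m + i) = 0" by blast
  define c where "c = (\<lambda>i j. if i + j = m + r then (-1) ^ i * newton (\<lambda>k. (-1) ^ r * e k) r i else 0)"
  have newton_e: "newton (\<lambda>k. (-1) ^ r * e k) r i = (-1) ^ r * newton e r i" for i
    by (simp add: newton_def sum_distrib_left mult_ac)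
  have DU: "c \<in> DU (int (m + r))" by (auto simp: DU_def c_def)
  have "i < m + 1 + u \<and> j < m + 1 + v" if "c i j \<noteq> 0" for i j
  proof -
    have ij: "i + j = m + r" and nz: "newton e r i \<noteq> 0"
      using that by (auto simp: c_def newton_e split: if_splits)
    have "i < m + 1 + u"
    proof (rule ccontr)
      assume "\<not> i < m + 1 + u"
      then have "m + (i - m) = i" "i - m \<le> r" "u < i - m" using ij by linarith+
      then show False using e(3) nz by metis
    qed
    moreover have "j < m + 1 + v"
    proof (rule ccontr)
      assume "\<not> j < m + 1 + v"
      then have "i + v < r" using ij by linarith
      then show False using e(2) nz by blast
    qed
    ultimately show ?thesis ..
  qed
  then have c: "c \<in> DU_box (int (m + r)) (m + 1 + u) (m + 1 + v)"
    using DU by (auto simp: DU_box_def box_def)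
  have "(omega1 ^^ r) c = alt m"
  proof (intro ext)
    fix i j
    show "(omega1 ^^ r) c i j = alt m i j"
    proof (cases "i + j = m")
      case True
      have "(-1) ^ i * (omega1 ^^ r) c i (m - i) =
          (-1) ^ r * (fdiff ^^ r) (newton (\<lambda>k. (-1) ^ r * e k) r) i"
        using True by (intro omega1_pow_fdiff) (auto simp: c_def minus_one_power_self)
      also have "\<dots> = 1" unfolding fdiff_pow_newton using e(1) by (simp add: power_add[symmetric])
      finally have "(-1) ^ i * ((-1) ^ i * (omega1 ^^ r) c i (m - i)) = (-1) ^ i * 1" by simp
      then have "(omega1 ^^ r) c i (m - i) = (-1) ^ i" unfolding minus_one_power_self by simp
      then show ?thesis using True by (auto simp: alt_def)
    next
      case False
      have "(omega1 ^^ r) c \<in> DU (int m)" using omega_pow_DU[OF DU, where n = r and ?X1.0 = 1 and ?X2.0 = 1] by simp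
      then have "(omega1 ^^ r) c i j = 0"
        using False unfolding DU_def by (metis (mono_tags, lifting) mem_Collect_eq of_nat_eq_iff)
      then show ?thesis using False by (simp add: alt_def)
    qed
  qed
  then show "J_monomial TYPE('k) m r u v"
    unfolding J_monomial_def using imageI[OF c, of "omega1 ^^ r"] by simp
qed

text \<open>The binomial coefficient is a coefficient of a power of \<open>1 + X\<close>, and
  \<open>(1 + X)^q = 1 + X^q\<close> in characteristic p. Each extra factor therefore changes only
  coefficients from \<open>X^q\<close> on, beyond \<open>k\<close>.\<close>

lemma choose_periodic:
  assumes "CHAR('k::field) > 0" "k < CHAR('k) ^ n"
  shows "(of_nat (i + CHAR('k) ^ n * t choose k) :: 'k) = of_nat (i choose k)"
proof (induction t)
  case (Suc t)
  let ?q = "CHAR('k) ^ n" and ?X = "[:0, 1 :: 'k:]"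
  have "prime CHAR('k poly)" using assms prime_CHAR_semidom[where ?'a = 'k] by simp
  then have "(1 + ?X) ^ ?q = 1 ^ ?q + ?X ^ ?q"
    using freshmans_dream'[where ?'a = "'k poly", of ?q n 1 ?X] by simp
  moreover have "1 + ?X = [:1, 1:]" by (simp add: one_pCons)
  ultimately have dream: "[:1, 1 :: 'k:] ^ ?q = 1 + ?X ^ ?q" by simp
  have choose: "Polynomial.coeff ([:1, 1 :: 'k:] ^ l) k = of_nat (l choose k)" for l
    by (cases "k \<le> l") (simp_all add: coeff_linear_poly_power coeff_eq_0 degree_linear_power binomial_eq_0)
  have "[:1, 1 :: 'k:] ^ (i + ?q * Suc t) = [:1, 1:] ^ (i + ?q * t) + ?X ^ ?q * [:1, 1:] ^ (i + ?q * t)"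
    by (simp add: power_add dream algebra_simps)
  moreover have "Polynomial.coeff (?X ^ ?q * [:1, 1:] ^ (i + ?q * t)) k = 0"
    using assms(2) by (simp add: coeff_monom_mult flip: monom_altdef[of "1 :: 'k", simplified])
  ultimately have "Polynomial.coeff ([:1, 1 :: 'k:] ^ (i + ?q * Suc t)) k =
      Polynomial.coeff ([:1, 1:] ^ (i + ?q * t)) k" by simp
  then show ?case unfolding choose using Suc by simp
qed simp

lemma J_monomial_periodic:
  assumes "CHAR('k::field) > 0" "r < CHAR('k) ^ n"
  shows "J_monomial TYPE('k) (m + CHAR('k) ^ n * t) r u v \<longleftrightarrow> J_monomial TYPE('k) m r u v"
proof -
  have "newton e r (m + CHAR('k) ^ n * t + i) = newton e r (m + i)" for e :: "nat \<Rightarrow> 'k" and i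
    unfolding newton_def
  proof (intro sum.cong refl)
    fix k assume "k \<in> {..r}"
    then have "k < CHAR('k) ^ n" using assms(2) by simp
    from choose_periodic[OF assms(1) this, of "m + i" t]
    show "of_nat (m + CHAR('k) ^ n * t + i choose k) * e k = of_nat (m + i choose k) * e k"
      by (simp add: ac_simps)
  qed
  then show ?thesis unfolding J_monomial_iff_newton by simp
qed

section \<open>The generator of the kernel of \<open>omega\<close> and the monomials of J\<close>

definition F1_gen :: "nat \<Rightarrow> nat \<Rightarrow> nat \<Rightarrow> 'k::field poly poly" where
  "F1_gen m = to_poly (m + 1) (m + 1) (alt m)"

lemma alt_box: "alt m \<in> box (m + 1) (m + 1)"
  by (auto simp: box_def alt_def)

lemma omega_F1_gen: "omega x1 x2 (F1_gen m) = 0"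
  unfolding F1_gen_def omega_to_poly[OF alt_box] omega1_alt
  by (simp add: to_poly_def zero_fun_apply fun_eq_iff)

lemma F1_gen_eq: "F1_gen m i j = (if i + j = m then (-1) ^ i * x1 ^ j * x2 ^ i else 0)"
proof (cases "i + j = m")
  case True
  have "bimonom ((-1) ^ i) j i = (-1) ^ i * bimonom 1 j i"
    by (cases "even i") (simp_all add: bimonom_def minus_monom)
  then show ?thesis using True
    by (auto simp: F1_gen_def to_poly_def alt_def x1_power x2_power bimonom_mult mult.assoc)
qed (simp add: F1_gen_def to_poly_def alt_def)

text \<open>As a polynomial in the outer variable, \<open>x1 ^ m\<close> is a constant, and
  multiplication by \<open>x2 ^ n\<close> only shifts the coefficients that it has to
  divide.\<close>

lemma x1_power_dvd:
  assumes "x1 ^ m dvd x2 ^ n * f" shows "x1 ^ m dvd (f :: 'k::field poly poly)"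
proof -
  have x1: "x1 ^ m = [:Polynomial.monom 1 m :: 'k poly:]"
    by (simp add: x1_power bimonom_def monom_0)
  have "Polynomial.monom 1 m dvd Polynomial.coeff f t" for t
  proof -
    have "Polynomial.coeff (x2 ^ n * f) (t + n) = Polynomial.coeff f t"
      by (simp add: x2_power bimonom_def coeff_monom_mult)
    then show ?thesis using assms unfolding x1 const_poly_dvd_iff by metis
  qed
  then show ?thesis unfolding x1 const_poly_dvd_iff by blast
qed

text \<open>Iterating \<open>x1 * f (i+1) j = - x2 * f i (j+1)\<close> gives
  \<open>x1^m * f m 0 = (-x2)^m * f 0 m\<close>. So \<open>x1^m\<close> divides
  \<open>f 0 m\<close>; the quotient \<open>s\<close> is the multiplier, and the recursion fixes all
  other entries after cancelling powers of \<open>x1\<close>.\<close>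

lemma F_module_1:
  "F_module (int m) 1 = (range (\<lambda>s i j. s * F1_gen m i j) :: (nat \<Rightarrow> nat \<Rightarrow> 'k::field poly poly) set)"
proof (intro equalityI subsetI)
  fix f :: "nat \<Rightarrow> nat \<Rightarrow> 'k poly poly" assume "f \<in> F_module (int m) 1"
  then have f: "f \<in> DU (int m)" and "omega x1 x2 f = 0" by (auto simp: F_module_def zero_fun_def)
  then have rec: "x1 * f (Suc i) j = - x2 * f i (Suc j)" for i j
  proof -
    have "omega x1 x2 f i j = 0" using \<open>omega x1 x2 f = 0\<close> by (simp add: zero_fun_apply)
    then show ?thesis by (simp add: omega_def eq_neg_iff_add_eq_0)
  qed
  have pow: "x1 ^ i * f i (m - i) = (- x2) ^ i * f 0 m" if "i \<le> m" for i
    using that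
  proof (induction i)
    case (Suc i)
    have "x1 ^ Suc i * f (Suc i) (m - Suc i) = x1 ^ i * (x1 * f (Suc i) (m - Suc i))"
      by (simp add: mult_ac)
    also have "\<dots> = x1 ^ i * (- x2 * f i (Suc (m - Suc i)))" unfolding rec ..
    also have "\<dots> = - x2 * (x1 ^ i * f i (m - i))"
      using Suc.prems by (simp add: mult_ac Suc_diff_Suc)
    finally show ?case using Suc by (simp add: mult_ac)
  qed simp
  have "x1 ^ m dvd (- x2) ^ m * f 0 m" using pow[of m] by (metis dvd_triv_left le_refl)
  then have "x1 ^ m dvd x2 ^ m * f 0 m" by (cases "even m") simp_all
  then obtain s where s: "f 0 m = x1 ^ m * s" using x1_power_dvd by (metis dvd_def)
  have "f i j = s * F1_gen m i j" for i j
  proof (cases "i + j = m")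
    case True
    have "x1 ^ i * f i j = (- x2) ^ i * (x1 ^ (i + j) * s)" using pow[of i] True s by auto
    also have "\<dots> = x1 ^ i * (s * F1_gen m i j)"
      unfolding F1_gen_eq using True by (auto simp: power_add mult_ac power_minus[of x2])
    finally show ?thesis by (simp add: x1_def)
  next
    case False
    then have "f i j = 0" using f unfolding DU_def by (metis (mono_tags, lifting) mem_Collect_eq of_nat_eq_iff)
    then show ?thesis using False by (simp add: F1_gen_eq)
  qed
  then have "f = (\<lambda>i j. s * F1_gen m i j)" by blast
  then show "f \<in> range (\<lambda>s i j. s * F1_gen m i j)" by blast
next
  fix f :: "nat \<Rightarrow> nat \<Rightarrow> 'k poly poly" assume "f \<in> range (\<lambda>s i j. s * F1_gen m i j)"
  then obtain s where f: "f = (\<lambda>i j. s * F1_gen m i j)" by blast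
  have "f \<in> DU (int m)" by (auto simp: f DU_def F1_gen_eq split: if_splits)
  moreover have "omega x1 x2 f = 0"
    unfolding f omega_scale omega_F1_gen by (simp add: fun_eq_iff zero_fun_apply)
  ultimately show "f \<in> F_module (int m) 1" by (simp add: F_module_def zero_fun_def)
qed

lemma F1_generator_F1_gen: "F1_generator (int m) (F1_gen m)"
  unfolding F1_generator_def
proof (intro conjI allI F_module_1)
  fix i j
  show "bihomogeneous (int m - int i) (int m - int j) (F1_gen m i j)"
    using bihomogeneous_bimonom[of "m - i" "m - j" "(-1) ^ i"]
    by (cases "i + j = m") (auto simp: F1_gen_def to_poly_def alt_def bihomogeneous_def)
qed

text \<open>Replaces the unspecified generator \<open>g\<close> by \<open>F1_gen\<close>, which is a
  multiple \<open>t * g\<close>: a preimage is multiplied by \<open>t\<close>. That the preimage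
  lies in the kernel of \<open>omega^(r+1)\<close> is automatic, because \<open>omega\<close> kills
  \<open>F1_gen\<close>.\<close>

lemma mem_J_base:
  fixes s :: "'k::field poly poly"
  shows "s \<in> J_base (int m + int r) r \<longleftrightarrow>
    (\<exists>f\<in>DU (int m + int r). (omega x1 x2 ^^ r) f = (\<lambda>i j. s * F1_gen m i j))"
  (is "_ \<longleftrightarrow> ?R")
proof
  assume "s \<in> J_base (int m + int r) r"
  then obtain g f where g: "F1_generator (int m) g" and f: "f \<in> DU (int m + int r)"
    and eq: "(\<lambda>i j. s * g i j) = (omega x1 x2 ^^ r) f"
    by (auto simp: J_base_def F_module_def)
  have "(F1_gen m :: nat \<Rightarrow> nat \<Rightarrow> 'k poly poly) \<in> F_module (int m) 1"
    unfolding F_module_1 by (rule range_eqI[of _ _ 1]) simp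
  also have "F_module (int m) 1 = range (\<lambda>s i j. s * g i j)" using g by (simp add: F1_generator_def)
  finally have "F1_gen m \<in> range (\<lambda>s i j. s * g i j)" .
  then obtain t where t: "F1_gen m = (\<lambda>i j. t * g i j)" by blast
  have "(omega x1 x2 ^^ r) (\<lambda>i j. t * f i j) = (\<lambda>i j. t * (s * g i j))"
    unfolding omega_pow_scale eq[symmetric] ..
  also have "\<dots> = (\<lambda>i j. s * F1_gen m i j)" by (simp add: t mult_ac)
  finally show ?R using DU_scale[OF f] by blast
next
  assume ?R
  then obtain f where f: "f \<in> DU (int m + int r)" "(omega x1 x2 ^^ r) f = (\<lambda>i j. s * F1_gen m i j)"
    by blast
  have "(omega x1 x2 ^^ (r + 1)) f = omega x1 x2 ((omega x1 x2 ^^ r) f)" by simp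
  also have "\<dots> = 0"
    unfolding f(2) omega_scale omega_F1_gen by (simp add: fun_eq_iff zero_fun_apply)
  finally have "f \<in> F_module (int m + int r) (r + 1)" using f(1) by (simp add: F_module_def zero_fun_def)
  then show "s \<in> J_base (int m + int r) r"
    unfolding J_base_def using F1_generator_F1_gen[of m] f(2)
    by (auto intro!: exI[of _ "F1_gen m"] image_eqI[of _ _ f])
qed

lemma J_base_add: "s \<in> J_base (int m + int r) r \<Longrightarrow> s' \<in> J_base (int m + int r) r \<Longrightarrow>
  s + s' \<in> J_base (int m + int r) r"
  unfolding mem_J_base
proof (elim bexE)
  fix f f' :: "nat \<Rightarrow> nat \<Rightarrow> 'a poly poly"
  assume f: "f \<in> DU (int m + int r)" "(omega x1 x2 ^^ r) f = (\<lambda>i j. s * F1_gen m i j)"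
    and f': "f' \<in> DU (int m + int r)" "(omega x1 x2 ^^ r) f' = (\<lambda>i j. s' * F1_gen m i j)"
  have "f + f' \<in> DU (int m + int r)"
    using f(1) f'(1) by (auto simp: DU_def plus_fun_apply) (metis add.right_neutral)
  moreover have "(omega x1 x2 ^^ r) (f + f') = (\<lambda>i j. (s + s') * F1_gen m i j)"
    unfolding omega_pow_add f(2) f'(2) by (simp add: fun_eq_iff plus_fun_apply algebra_simps)
  ultimately show "\<exists>f\<in>DU (int m + int r). (omega x1 x2 ^^ r) f = (\<lambda>i j. (s + s') * F1_gen m i j)"
    by blast
qed

lemma zero_J_base: "0 \<in> J_base (int m + int r) r"
  unfolding mem_J_base
  by (rule bexI[of _ 0]) (simp_all add: omega_pow_zero DU_def fun_eq_iff zero_fun_apply)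

text \<open>The projection to the component of bidegree \<open>(a-1,b-1)\<close>, recorded as a
  scalar array; the counterpart of \<open>to_poly\<close>.\<close>

definition bipart :: "nat \<Rightarrow> nat \<Rightarrow> (nat \<Rightarrow> nat \<Rightarrow> 'k::field poly poly) \<Rightarrow> nat \<Rightarrow> nat \<Rightarrow> 'k" where
  "bipart a b f = (\<lambda>i j. if i < a \<and> j < b
     then Polynomial.coeff (Polynomial.coeff (f i j) (b - 1 - j)) (a - 1 - i) else 0)"

lemma coeff_bimonom_mult:
  "Polynomial.coeff (Polynomial.coeff (bimonom c s t * f) v) u =
    (if s \<le> u \<and> t \<le> v then c * Polynomial.coeff (Polynomial.coeff f (v - t)) (u - s) else 0)"
  by (simp add: bimonom_def coeff_monom_mult)

lemma bipart_omega: "bipart a b (omega x1 x2 f) = omega1 (bipart a b f)"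
proof (intro ext)
  fix i j
  show "bipart a b (omega x1 x2 f) i j = omega1 (bipart a b f) i j"
  proof (cases "i < a \<and> j < b")
    case True
    have "a - Suc i - Suc 0 = a - Suc (Suc i)" "b - Suc j - Suc 0 = b - Suc (Suc j)" by auto
    then show ?thesis using True
      by (auto simp: bipart_def omega_def x1_bimonom x2_bimonom coeff_bimonom_mult)
  qed (auto simp: bipart_def omega_def)
qed

lemma bipart_omega_pow: "bipart a b ((omega x1 x2 ^^ n) f) = (omega1 ^^ n) (bipart a b f)"
  by (induction n) (simp_all add: bipart_omega)

lemma bipart_DU_box: "f \<in> DU d \<Longrightarrow> bipart a b f \<in> DU_box d a b"
  by (auto simp: DU_box_def DU_def box_def bipart_def split: if_splits) force

lemma bipart_F1_gen:
  fixes s :: "'k::field poly poly"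
  shows "bipart (m + 1 + u) (m + 1 + v) (\<lambda>i j. s * F1_gen m i j) =
    (\<lambda>i j. Polynomial.coeff (Polynomial.coeff s v) u * alt m i j)"
proof (intro ext)
  fix i j
  show "bipart (m + 1 + u) (m + 1 + v) (\<lambda>i j. s * F1_gen m i j) i j =
    Polynomial.coeff (Polynomial.coeff s v) u * alt m i j"
  proof (cases "i + j = m")
    case True
    then have "F1_gen m i j = bimonom ((-1) ^ i :: 'k) j i"
      by (auto simp: F1_gen_def to_poly_def alt_def)
    then show ?thesis
      using True by (auto simp: bipart_def alt_def mult.commute[of s] coeff_bimonom_mult)
  qed (simp add: bipart_def F1_gen_eq alt_def)
qed

lemma bimonom_J_base:
  fixes c :: "'k::field"
  assumes "J_monomial TYPE('k) m r u v"
  shows "bimonom c u v \<in> J_base (int m + int r) r"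
proof -
  let ?a = "m + 1 + u" and ?b = "m + 1 + v"
  obtain h :: "nat \<Rightarrow> nat \<Rightarrow> 'k" where h: "h \<in> DU_box (int (m + r)) ?a ?b" "alt m = (omega1 ^^ r) h"
    using assms unfolding J_monomial_def by blast
  have "to_poly ?a ?b (\<lambda>i j. c * h i j) \<in> DU (int m + int r)"
    using h(1) by (auto simp: DU_def DU_box_def to_poly_def)
  moreover have "(omega x1 x2 ^^ r) (to_poly ?a ?b (\<lambda>i j. c * h i j)) = to_poly ?a ?b (\<lambda>i j. c * alt m i j)"
    using DU_box_scale[OF h(1), of c] unfolding h(2)
    by (subst omega_pow_to_poly) (simp_all add: DU_box_def omega_pow_scale)
  moreover have "to_poly ?a ?b (\<lambda>i j. c * alt m i j) = (\<lambda>i j. bimonom c u v * F1_gen m i j)"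
    by (auto simp: fun_eq_iff to_poly_def F1_gen_def alt_def bimonom_mult add.commute)
  ultimately show ?thesis unfolding mem_J_base by metis
qed

lemma bimonom_expansion:
  "s = (\<Sum>v\<le>Polynomial.degree s. \<Sum>u\<le>Polynomial.degree (Polynomial.coeff s v).
    bimonom (Polynomial.coeff (Polynomial.coeff s v) u) u v)"
proof -
  have "(\<Sum>u\<le>Polynomial.degree p. bimonom (Polynomial.coeff p u) u v) = Polynomial.monom p v" for p :: "'a poly" and v
    unfolding bimonom_def monom_sum[symmetric] poly_as_sum_of_monoms ..
  then show ?thesis by (simp add: poly_as_sum_of_monoms)
qed

text \<open>\<open>omega\<close> preserves bidegrees, so projecting a preimage to bidegree
  \<open>(m+u,m+v)\<close> and dividing by the coefficient of \<open>x1^u x2^v\<close> gives a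
  preimage of \<open>alt m\<close>. Conversely, a polynomial is the sum of its monomials.\<close>

lemma J_base_eq:
  "J_base (int m + int r) r = {s :: 'k::field poly poly. \<forall>u v.
    Polynomial.coeff (Polynomial.coeff s v) u \<noteq> 0 \<longrightarrow> J_monomial TYPE('k) m r u v}"
proof (intro equalityI subsetI CollectI allI impI)
  fix s :: "'k poly poly" and u v
  assume "s \<in> J_base (int m + int r) r" and nz: "Polynomial.coeff (Polynomial.coeff s v) u \<noteq> 0"
  then obtain f where f: "f \<in> DU (int m + int r)" "(omega x1 x2 ^^ r) f = (\<lambda>i j. s * F1_gen m i j)"
    unfolding mem_J_base by blast
  let ?a = "m + 1 + u" and ?b = "m + 1 + v" and ?c = "Polynomial.coeff (Polynomial.coeff s v) u"
  have "(omega1 ^^ r) (bipart ?a ?b f) = (\<lambda>i j. ?c * alt m i j)"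
    unfolding bipart_omega_pow[symmetric] f(2) by (rule bipart_F1_gen)
  then have "(omega1 ^^ r) (\<lambda>i j. inverse ?c * bipart ?a ?b f i j) = alt m"
    unfolding omega_pow_scale using nz by (simp add: fun_eq_iff)
  moreover have "(\<lambda>i j. inverse ?c * bipart ?a ?b f i j) \<in> DU_box (int (m + r)) ?a ?b"
    using bipart_DU_box[OF f(1)] by (intro DU_box_scale) simp
  ultimately show "J_monomial TYPE('k) m r u v" unfolding J_monomial_def by (metis imageI)
next
  fix s :: "'k poly poly"
  assume s: "s \<in> {s. \<forall>u v. Polynomial.coeff (Polynomial.coeff s v) u \<noteq> 0 \<longrightarrow> J_monomial TYPE('k) m r u v}"
  have sum: "sum g A \<in> J_base (int m + int r) r"
    if "\<And>x. x \<in> A \<Longrightarrow> g x \<in> J_base (int m + int r) r" for g :: "nat \<Rightarrow> 'k poly poly" and A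
    using that
    by (induction A rule: infinite_finite_induct) (auto simp: zero_J_base J_base_add)
  have "bimonom (Polynomial.coeff (Polynomial.coeff s v) u) u v \<in> J_base (int m + int r) r" for u v
    by (cases "Polynomial.coeff (Polynomial.coeff s v) u = 0")
      (use s in \<open>auto intro: bimonom_J_base zero_J_base\<close>)
  then show "s \<in> J_base (int m + int r) r"
    by (subst bimonom_expansion) (intro sum)
qed

lemma J_base_periodic:
  assumes p: "CHAR('k::field) > 0" "r < CHAR('k) ^ n"
    and d: "int r \<le> d" "int r \<le> d'" "int (CHAR('k) ^ n) dvd d' - d"
  shows "J_base d' r = (J_base d r :: 'k poly poly set)"
proof -
  have *: "J_base d' r = (J_base d r :: 'k poly poly set)"
    if d: "int r \<le> d" "d \<le> d'" "int (CHAR('k) ^ n) dvd d' - d" for d d'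
  proof -
    obtain m where m: "d = int m + int r"
      using d(1) by (metis add.commute zle_iff_zadd)
    obtain t where t: "d' - d = int (CHAR('k) ^ n) * t" using d(3) by blast
    have "0 \<le> t"
      using d(2) t p by (metis diff_ge_0_iff_ge of_nat_0_less_iff zero_le_mult_iff zero_less_power not_less)
    then have "d' = int (m + CHAR('k) ^ n * nat t) + int r" using t m by simp
    then show ?thesis
      unfolding m by (simp only: J_base_eq J_monomial_periodic[OF p])
  qed
  show ?thesis
  proof (cases "d \<le> d'")
    case True
    then show ?thesis using * d by blast
  next
    case False
    have "int (CHAR('k) ^ n) dvd d - d'" using d(3) by (simp add: dvd_diff_commute)
    then show ?thesis using *[of d' d] d False by simp
  qed
qed

text \<open>Evaluates the definite description in the case \<open>d < r\<close>. The modulus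
  \<open>p^r\<close> is always admissible, since \<open>r < 2^r\<close> and p is at least 2.\<close>

lemma J_ideal_eq:
  assumes p: "CHAR('k::field) > 0"
  obtains m t where "int m + int r = d + int (CHAR('k) ^ r * t)"
    "J_ideal d r = (J_base (int m + int r) r :: 'k poly poly set)" "int r \<le> d \<Longrightarrow> t = 0"
proof (cases "int r \<le> d")
  case True
  show thesis
    by (rule that[of "nat (d - int r)" 0]) (use True in \<open>simp_all add: J_ideal_def\<close>)
next
  case False
  have "2 \<le> CHAR('k)" using prime_CHAR_semidom[OF p] prime_ge_2_nat by blast
  then have r: "r < CHAR('k) ^ r" by (meson less_exp order_less_le_trans power_mono zero_le)
  \<comment> \<open>Any multiple of the modulus that lifts \<open>d\<close> to at least
    \<open>r\<close> would do; this one works because the modulus is at least 1.\<close>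
  define t where "t = r + nat \<bar>d\<bar>"
  have "1 * t \<le> CHAR('k) ^ r * t" using r by (intro mult_right_mono) auto
  then have "int t \<le> int (CHAR('k) ^ r * t)" by (simp only: of_nat_le_iff mult_1)
  moreover have "int t = int r + \<bar>d\<bar>" by (simp add: t_def)
  ultimately have d': "int r \<le> d + int (CHAR('k) ^ r * t)" by linarith
  define m where "m = nat (d + int (CHAR('k) ^ r * t) - int r)"
  have m: "int m + int r = d + int (CHAR('k) ^ r * t)" using d' by (simp add: m_def)
  let ?Q = "\<lambda>I. \<exists>n d'. r < CHAR('k) ^ n \<and> int r \<le> d' \<and> int (CHAR('k) ^ n) dvd d' - d \<and>
                          I = (J_base d' r :: 'k poly poly set)"
  have "(THE I. ?Q I) = J_base (int m + int r) r"
  proof (rule the_equality)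
    show "?Q (J_base (int m + int r) r)"
      using r d' m by (intro exI[of _ r] exI[of _ "int m + int r"]) simp
    fix I assume "?Q I"
    then obtain n d' where n: "r < CHAR('k) ^ n" "int r \<le> d'" "int (CHAR('k) ^ n) dvd d' - d"
      and I: "I = J_base d' r" by blast
    \<comment> \<open>Two admissible moduli are powers of p; the smaller one divides both and still
      exceeds \<open>r\<close>, so \<open>J_base_periodic\<close> applies to it.\<close>
    let ?k = "min n r"
    have k: "r < CHAR('k) ^ ?k" using n(1) r by (simp add: min_def)
    have "int (CHAR('k) ^ ?k) dvd d' - d"
      using n(3) by (rule dvd_trans[rotated]) (simp add: le_imp_power_dvd)
    moreover have "int (CHAR('k) ^ ?k) dvd (int m + int r) - d"
      unfolding m by (simp add: le_imp_power_dvd dvd_mult2)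
    ultimately have "int (CHAR('k) ^ ?k) dvd d' - d - ((int m + int r) - d)" by (rule dvd_diff)
    then have "int (CHAR('k) ^ ?k) dvd d' - (int m + int r)" by (simp only: diff_diff_eq2 diff_add_cancel)
    then show "I = J_base (int m + int r) r"
      unfolding I using J_base_periodic[OF p k, of "int m + int r" d'] n(2) by simp
  qed
  then have "J_ideal d r = (J_base (int m + int r) r :: 'k poly poly set)"
    using False by (simp only: J_ideal_def if_False)
  then show thesis using that[OF m] False by blast
qed

text \<open>A bihomogeneous polynomial is a scalar multiple of a single monomial, and nonzero only
  for nonnegative bidegree. So the component is nonzero exactly when that monomial lies in
  \<open>I\<close> and outside \<open>J\<close>.\<close>

lemma quotient_component_nonzero_iff:
  assumes I: "I = (J_base (int m' + int r') r' :: 'k::field poly poly set)"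
    and J: "J = (J_base (int m + int r) r :: 'k poly poly set)"
  shows "quotient_component I J u v \<noteq> {J} \<longleftrightarrow>
    0 \<le> u \<and> 0 \<le> v \<and> J_monomial TYPE('k) m' r' (nat u) (nat v) \<and> \<not> J_monomial TYPE('k) m r (nat u) (nat v)"
proof -
  have J_minus: "f - s \<in> J" if "f \<in> J" "s \<in> J" for f s
    using that unfolding J J_base_eq by (auto, metis diff_self)
  have J_add: "f + s \<in> J" if "f \<in> J" "s \<in> J" for f s
    using that J_base_add unfolding J by blast
  have J0: "0 \<in> J" and I0: "0 \<in> I" unfolding I J by (rule zero_J_base)+
  have coset: "(\<lambda>s. f + s) ` J = J \<longleftrightarrow> f \<in> J" for f
  proof
    assume "(\<lambda>s. f + s) ` J = J"
    then have "f + 0 \<in> J" using J0 by blast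
    then show "f \<in> J" by simp
  next
    assume f: "f \<in> J"
    show "(\<lambda>s. f + s) ` J = J"
    proof
      show "(\<lambda>s. f + s) ` J \<subseteq> J" using f J_add by blast
      show "J \<subseteq> (\<lambda>s. f + s) ` J"
        using f J_minus by (intro subsetI image_eqI[of _ _ "_ - f"]) auto
    qed
  qed
  have mem: "bimonom c s t \<in> J_base (int m + int r) r \<longleftrightarrow> (c \<noteq> 0 \<longrightarrow> J_monomial TYPE('k) m r s t)"
    for c :: 'k and s t m r
    unfolding J_base_eq by (auto simp: coeff_bimonom)
  have "quotient_component I J u v \<noteq> {J} \<longleftrightarrow> (\<exists>f\<in>I. bihomogeneous u v f \<and> f \<notin> J)"
  proof -
    have "J \<in> quotient_component I J u v"
      using I0 unfolding quotient_component_def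
      by (intro CollectI exI[of _ 0]) (auto simp: bihomogeneous_def)
    then have "quotient_component I J u v \<noteq> {J} \<longleftrightarrow> (\<exists>C\<in>quotient_component I J u v. C \<noteq> J)" by blast
    also have "\<dots> \<longleftrightarrow> (\<exists>f\<in>I. bihomogeneous u v f \<and> (\<lambda>s. f + s) ` J \<noteq> J)"
      unfolding quotient_component_def by blast
    also have "\<dots> \<longleftrightarrow> (\<exists>f\<in>I. bihomogeneous u v f \<and> f \<notin> J)" unfolding coset ..
    finally show ?thesis .
  qed
  also have "\<dots> \<longleftrightarrow> 0 \<le> u \<and> 0 \<le> v \<and> J_monomial TYPE('k) m' r' (nat u) (nat v) \<and>
      \<not> J_monomial TYPE('k) m r (nat u) (nat v)"
  proof
    assume "\<exists>f\<in>I. bihomogeneous u v f \<and> f \<notin> J"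
    then obtain f where f: "f \<in> I" "bihomogeneous u v f" "f \<notin> J" by blast
    then obtain c where "f = bimonom c (nat u) (nat v)" "c \<noteq> 0 \<longrightarrow> 0 \<le> u \<and> 0 \<le> v"
      using bihomogeneous_imp_bimonom by blast
    then show "0 \<le> u \<and> 0 \<le> v \<and> J_monomial TYPE('k) m' r' (nat u) (nat v) \<and>
        \<not> J_monomial TYPE('k) m r (nat u) (nat v)"
      using f mem unfolding I J by blast
  next
    assume R: "0 \<le> u \<and> 0 \<le> v \<and> J_monomial TYPE('k) m' r' (nat u) (nat v) \<and>
        \<not> J_monomial TYPE('k) m r (nat u) (nat v)"
    have "bihomogeneous u v (bimonom (1::'k) (nat u) (nat v))"
      using bihomogeneous_bimonom[of "nat u" "nat v" "1::'k"] R by simp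
    then show "\<exists>f\<in>I. bihomogeneous u v f \<and> f \<notin> J"
      using R mem[of 1] unfolding I J by (metis zero_neq_one)
  qed
  finally show ?thesis .
qed

text \<open>For \<open>r \<le> d\<close> both ideals refer to the same \<open>m = d - r\<close>, and
  the bidegree is chosen so that the boxes in \<open>J_monomial\<close> have sides \<open>a\<close>
  and \<open>b\<close>. For \<open>d < r\<close> there is no string, and it must be shown that the
  monomial already lies in \<open>J(d,r)\<close>.\<close>

lemma quotient_component_iff_string_class:
  fixes a b r :: nat and d :: int
  assumes p: "CHAR('k::field) > 0" and r: "0 < r"
  shows "quotient_component (J_ideal (d - 1) (r - 1)) (J_ideal d r)
          (int a - 1 + int r - d) (int b - 1 + int r - d) \<noteq> {J_ideal d r :: 'k poly poly set}
      \<longleftrightarrow> string_class TYPE('k) a b d r"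
proof -
  let ?u = "int a - 1 + int r - d" and ?v = "int b - 1 + int r - d"
  obtain m t where m: "int m + int r = d + int (CHAR('k) ^ r * t)"
    "J_ideal d r = (J_base (int m + int r) r :: 'k poly poly set)" "int r \<le> d \<Longrightarrow> t = 0"
    using J_ideal_eq[OF p] by metis
  obtain m' t' where m': "int m' + int (r - 1) = d - 1 + int (CHAR('k) ^ (r - 1) * t')"
    "J_ideal (d - 1) (r - 1) = (J_base (int m' + int (r - 1)) (r - 1) :: 'k poly poly set)"
    "int (r - 1) \<le> d - 1 \<Longrightarrow> t' = 0"
    using J_ideal_eq[OF p] by metis
  note iff = quotient_component_nonzero_iff[OF m'(2) m(2), of ?u ?v]
  show ?thesis
  proof (cases "int r \<le> d")
    case True
    then have d: "d = int m + int r" using m by simp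
    have "m' = m" using m' d r by (simp add: of_nat_diff)
    have di: "int (m + r) = d" "int (m + (r - 1)) = d - 1" using d r by simp_all
    show ?thesis
    proof (cases "m < a \<and> m < b")
      case ab: True
      then have uv: "0 \<le> ?u" "0 \<le> ?v" "m + 1 + nat ?u = a" "m + 1 + nat ?v = b" using d by auto
      show ?thesis
        unfolding iff string_class_iff_alt[OF r d] J_monomial_def \<open>m' = m\<close> uv(3,4) di
        using ab uv(1,2) by blast
    next
      case False
      then have "\<not> (0 \<le> ?u \<and> 0 \<le> ?v)" using d by auto
      then show ?thesis unfolding iff string_class_iff_alt[OF r d] using False by blast
    qed
  next
    case False
    have "2 \<le> CHAR('k)" using prime_CHAR_semidom[OF p] prime_ge_2_nat by blast
    then have q: "r < CHAR('k) ^ r" by (meson less_exp order_less_le_trans power_mono zero_le)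
    \<comment> \<open>The witness is the single polynomial \<open>binom(i,r)\<close>: its zeros at
      \<open>0..r-1\<close> serve the lower end directly and, by periodicity, the upper end as
      well.\<close>
    define e :: "nat \<Rightarrow> 'k" where "e k = (if k = r then 1 else 0)" for k
    have newton_e: "newton e r i = of_nat (i choose r)" for i
      by (simp add: newton_def e_def if_distrib[of "\<lambda>x. _ * x"] cong: if_cong)
    have "newton e r (m + i) = 0" if "i \<le> r" "nat ?u < i" for i
    proof -
      \<comment> \<open>From \<open>i > a - 1 + r - d\<close> follows that
        \<open>l = i + d - r\<close> is at least \<open>a\<close>, hence nonnegative, and
        \<open>i \<le> r\<close> with \<open>d < r\<close> gives \<open>l < r\<close>. As
        \<open>m + i\<close> is congruent to \<open>l\<close>, a zero of \<open>binom(l,r)\<close>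
        is hit.\<close>
      have "0 \<le> int i + d - int r" using that by linarith
      define l where "l = nat (int i + d - int r)"
      have "m + i = l + CHAR('k) ^ r * t"
        using m(1) \<open>0 \<le> int i + d - int r\<close> unfolding l_def by linarith
      moreover have "l < r" using that False \<open>0 \<le> int i + d - int r\<close> unfolding l_def by linarith
      ultimately show ?thesis unfolding newton_e using choose_periodic[OF p q] by (simp add: binomial_eq_0)
    qed
    moreover have "newton e r i = 0" if "i + nat ?v < r" for i
      using that by (simp add: newton_e binomial_eq_0)
    ultimately have "J_monomial TYPE('k) m r (nat ?u) (nat ?v)"
      unfolding J_monomial_iff_newton by (intro exI[of _ e]) (simp add: e_def)
    moreover have "\<not> string_class TYPE('k) a b d r"
      by (rule not_string_class[OF r]) (use False in simp)
    ultimately show ?thesis using iff by simp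
  qed
qed

theorem theorem5p2:
  fixes a b j r :: nat and d e :: int
  assumes "CHAR('k::alg_closed_field) > 0"
    and "r > 0"
    and "d = int a + int b - 1 - int j"
    and "e = int j - 1"
  shows
    "(delta_summand r (int j) (gtensor (delta a 0) (delta b 0) :: ('k, nat \<times> nat) gmod)
        \<longleftrightarrow>
      quotient_component (J_ideal (d - 1) (r - 1)) (J_ideal d r)
          (int a - 1 + int r - d) (int b - 1 + int r - d) \<noteq> {J_ideal d r :: 'k poly poly set})
     \<and>
     (quotient_component (J_ideal (d - 1) (r - 1)) (J_ideal d r)
          (int a - 1 + int r - d) (int b - 1 + int r - d) \<noteq> {J_ideal d r :: 'k poly poly set}
        \<longleftrightarrow>
      \<not> (H0_F (d - 1) r (e + 1) (int a - 1) (int b - 1)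
            :: ('k poly poly set \<Rightarrow> nat \<Rightarrow> nat \<Rightarrow> 'k poly poly fract) set)
          \<subseteq> beta ` (H0_F d (r + 1) e (int a - 1) (int b - 1) \<times>
                     H0_F (d - 1) (r - 1) (e + 1) (int a - 1) (int b - 1)))"
proof -
  have deg: "int a + int b - 2 = d + e" using assms(3,4) by simp
  have "delta_summand r (int j) (gtensor (delta a 0) (delta b 0) :: ('k, nat \<times> nat) gmod) \<longleftrightarrow>
      string_class TYPE('k) a b d r"
    unfolding delta_summand_iff[OF graded_tensor assms(2)] by (rule has_string_tensor[OF assms(3)])
  then show ?thesis
    unfolding quotient_component_iff_string_class[OF assms(1,2)] beta_surjective_iff[OF deg assms(2)]
    by simp
qed
end
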